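(* Let $\mathbb{M}=(M_j)_{j\in\mathbb{N}_0}$ be a sequence of positive real numbers with $M_0=1$ and let $\alpha>1$. Suppose there exists $\alpha'>\alpha$ such that $\overline{\mathbb{G}}^{1-\alpha'}\mathbb{M}=(j^{(1-\alpha')j}M_j)_{j\in\mathbb{N}_0}$ is equivalent to a log-convex sequence $\mathbb{L}$ (depending on $\alpha'$). Then the following assertions are equivalent: (a) The sequence $\mathbb{M}$ has property (rai). (b) The class $\mathcal{A}_{\{\mathbb{M}\}}(S_\alpha)$ is holomorphically closed. (c) The class $\mathcal{A}_{\{\mathbb{M}\}}(S_\alpha)$ is inverse-closed. If in addition $\liminf_{j\to\infty}(M_j/j!)^{1/j}>0$ and $\mathbb{M}$ satisfies (dc), then (a), (b), (c) are also equivalent to each of: (d) The class $\mathcal{A}_{\{\mathbb{M}\}}(S_\alpha)$ is closed under composition. (e) The sequence $\mathbb{M}$ has property (FdB).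
   Context: $\mathbb{N}_0=\{0,1,2,\dots\}$, $\mathbb{N}=\{1,2,\dots\}$, $0^0:=1$. A positive sequence is log-convex if $M_j^2\le M_{j-1}M_{j+1}$ for $j\ge1$. Two positive sequences $\mathbb{M},\mathbb{L}$ are equivalent if there are $A,B>0$ with $M_j\le AB^jL_j$ and $L_j\le AB^jM_j$ for all $j\in\mathbb{N}_0$. Write $\check M_j:=M_j/j!$. - (rai): $\exists C>0\ \forall1\le j\le k$: $\check M_j^{1/j}\le C\check M_k^{1/k}$. - (dc): $\exists D\ge1\ \forall j\in\mathbb{N}_0$: $M_{j+1}\le D^{j+1}M_j$. - (FdB): $\exists C,h\ge1\ \forall j\in\mathbb{N}_0$: $\check M^\circ_j\le Ch^j\check M_j$, where $\check M^\circ_0:=1$ and $\check M^\circ_k:=\max\{\check M_\ell\check M_{j_1}\cdots\check M_{j_\ell}:\ell\in\mathbb{N},\ j_i\in\mathbb{N},\ \sum_{i=1}^\ell j_i=k\}$ for $k\ge1$. $\mathcal{R}$ is the Riemann surface of the logarithm and $S_\alpha:=\{z\in\mathcal{R}:|\arg z|<\alpha\pi/2\}$; derivatives are with respect to the coordinate $z$; $\mathcal{H}(\cdot)$ denotes holomorphic functions. $\mathcal{A}_{\{\mathbb{M}\}}(S)$ is the set of $f\in\mathcal{H}(S)$ for which there is $h>0$ with $\sup_{z\in S,j\in\mathbb{N}_0}\frac{|f^{(j)}(z)|}{h^jM_j}<\infty$. For $U\subseteq\mathbb{C}$ open, $\mathcal{H}_{\{\mathbb{M}\}}(U)$ is the set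 of $g\in\mathcal{H}(U)$ such that for each compact $K\subset U$ there is $h>0$ with $\sup_{z\in K,j\in\mathbb{N}_0}\frac{|g^{(j)}(z)|}{h^jM_j}<\infty$. The class $\mathcal{A}:=\mathcal{A}_{\{\mathbb{M}\}}(S_\alpha)$ is: holomorphically closed if $g\circ f\in\mathcal{A}$ for all $f\in\mathcal{A}$ and all $g\in\mathcal{H}(U)$ with $U\subseteq\mathbb{C}$ open containing the closure of the range of $f$; inverse-closed if $1/f\in\mathcal{A}$ for all $f\in\mathcal{A}$ with $\inf_{z\in S_\alpha}|f(z)|>0$; closed under composition if $g\circ f\in\mathcal{A}$ for all $f\in\mathcal{A}$ and all $g\in\mathcal{H}_{\{\mathbb{M}\}}(U)$ with $U\subseteq\mathbb{C}$ open containing the closure of the range of $f$. *)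

theory Defs
  imports "HOL-Complex_Analysis.Complex_Analysis"
begin

section \<open>Weight sequences\<close>

definition positive_seq :: "(nat \<Rightarrow> real) \<Rightarrow> bool" where
  "positive_seq M \<longleftrightarrow> (\<forall>j. 0 < M j)"

definition log_convex_seq :: "(nat \<Rightarrow> real) \<Rightarrow> bool" where
  "log_convex_seq M \<longleftrightarrow> positive_seq M \<and> (\<forall>j\<ge>1. (M j)\<^sup>2 \<le> M (j - 1) * M (j + 1))"

definition equivalent_seq :: "(nat \<Rightarrow> real) \<Rightarrow> (nat \<Rightarrow> real) \<Rightarrow> bool" where
  "equivalent_seq M L \<longleftrightarrow>
     (\<exists>A>0. \<exists>B>0. \<forall>j. M j \<le> A * B ^ j * L j \<and> L j \<le> A * B ^ j * M j)"

text \<open>The sequence \<open>(j\<^bsup>s j\<^esup> M\<^sub>j)\<^sub>j\<close> with the convention \<open>0\<^sup>0 = 1\<close>. The case distinction is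
  needed because \<^term>\<open>(0::real) powr 0\<close> is \<open>0\<close>.\<close>

definition gevrey_scale :: "real \<Rightarrow> (nat \<Rightarrow> real) \<Rightarrow> nat \<Rightarrow> real" where
  "gevrey_scale s M j = (if j = 0 then 1 else real j powr (s * real j)) * M j"

definition check_seq :: "(nat \<Rightarrow> real) \<Rightarrow> nat \<Rightarrow> real" where
  "check_seq M j = M j / fact j"

definition rai :: "(nat \<Rightarrow> real) \<Rightarrow> bool" where
  "rai M \<longleftrightarrow> (\<exists>C>0. \<forall>j k. 1 \<le> j \<and> j \<le> k \<longrightarrow>
     check_seq M j powr (1 / real j) \<le> C * check_seq M k powr (1 / real k))"

definition dc :: "(nat \<Rightarrow> real) \<Rightarrow> bool" where
  "dc M \<longleftrightarrow> (\<exists>D\<ge>1. \<forall>j. M (j + 1) \<le> D ^ (j + 1) * M j)"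

text \<open>The tuples \<open>(j\<^sub>1, \<dots>, j\<^sub>\<ell>)\<close> of positive integers with sum \<open>k\<close> (and \<open>\<ell> \<ge> 1\<close>) are lists.\<close>

definition compositions :: "nat \<Rightarrow> nat list set" where
  "compositions k = {js. js \<noteq> [] \<and> (\<forall>j\<in>set js. 1 \<le> j) \<and> sum_list js = k}"

definition circ_seq :: "(nat \<Rightarrow> real) \<Rightarrow> nat \<Rightarrow> real" where
  "circ_seq m k = (if k = 0 then 1
     else Max {m (length js) * prod_list (map m js) |js. js \<in> compositions k})"

text \<open>The maximum is over a finite nonempty set.\<close>

lemma finite_compositions: "finite (compositions k)"
proof (rule finite_subset)
  have len: "length js \<le> sum_list js" if "\<forall>j\<in>set js. 1 \<le> j" for js :: "nat list"
    using that by (induction js) auto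
  show "compositions k \<subseteq> {js. set js \<subseteq> {..k} \<and> length js \<le> k}"
    using len member_le_sum_list by (fastforce simp: compositions_def)
qed (simp add: finite_lists_length_le)

lemma compositions_nonempty: "k \<ge> 1 \<Longrightarrow> compositions k \<noteq> {}"
  by (auto simp: compositions_def intro!: exI[of _ "[k]"])

definition FdB :: "(nat \<Rightarrow> real) \<Rightarrow> bool" where
  "FdB M \<longleftrightarrow> (\<exists>C\<ge>1. \<exists>h\<ge>1. \<forall>j. circ_seq (check_seq M) j \<le> C * h ^ j * check_seq M j)"

section \<open>Sectors of the Riemann surface of the logarithm\<close>

text \<open>The Riemann surface of the logarithm is the universal covering of the punctured plane. It is
  modelled by the complex plane with covering map \<^term>\<open>exp\<close>: a point \<open>p\<close> is represented by its
  logarithm, so its coordinate is \<open>z = exp p\<close>, its modulus \<open>exp (Re p)\<close> and its argument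
  \<open>Im p\<close>. As \<^term>\<open>exp\<close> is locally biholomorphic, holomorphy on the surface is holomorphy in
  \<open>p\<close>. No restriction such as \<open>\<alpha> \<le> 2\<close> is needed.\<close>

type_synonym log_surface = complex

definition sector :: "real \<Rightarrow> log_surface set" where
  "sector \<alpha> = {p. \<bar>Im p\<bar> < \<alpha> * pi / 2}"

text \<open>\<open>z \<mapsto> p + Ln (z / exp p)\<close> is the local inverse of the coordinate \<^term>\<open>exp\<close> sending
  \<open>exp p\<close> to \<open>p\<close>; the derivative with respect to \<open>z\<close> is the derivative in this chart.\<close>

definition zderiv :: "(log_surface \<Rightarrow> complex) \<Rightarrow> log_surface \<Rightarrow> complex" where
  "zderiv f p = deriv (\<lambda>z. f (p + Ln (z / exp p))) (exp p)"

lemma zderiv_eq: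
  assumes "f field_differentiable at p"
  shows "zderiv f p = deriv f p / exp p"
proof -
  have "((\<lambda>z. p + Ln (z / exp p)) has_field_derivative 1 / exp p) (at (exp p))"
    by (auto intro!: derivative_eq_intros simp: field_simps)
  moreover have "(f has_field_derivative deriv f p) (at (p + Ln (exp p / exp p)))"
    using assms by (simp add: field_differentiable_derivI)
  ultimately have "((\<lambda>z. f (p + Ln (z / exp p))) has_field_derivative deriv f p * (1 / exp p))
      (at (exp p))"
    by (rule DERIV_chain2[rotated])
  then show ?thesis
    unfolding zderiv_def by (simp add: DERIV_imp_deriv)
qed

section \<open>Ultraholomorphic and ultradifferentiable classes\<close>

text \<open>Elements are total functions of which only the values on the (open) domain matter.\<close>

definition class_A :: "(nat \<Rightarrow> real) \<Rightarrow> log_surface set \<Rightarrow> (log_surface \<Rightarrow> complex) set" where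
  "class_A M S = {f. f holomorphic_on S \<and>
     (\<exists>h>0. \<exists>C. \<forall>p\<in>S. \<forall>j. cmod ((zderiv ^^ j) f p) / (h ^ j * M j) \<le> C)}"

definition class_H :: "(nat \<Rightarrow> real) \<Rightarrow> complex set \<Rightarrow> (complex \<Rightarrow> complex) set" where
  "class_H M U = {g. g holomorphic_on U \<and>
     (\<forall>K. compact K \<and> K \<subseteq> U \<longrightarrow>
       (\<exists>h>0. \<exists>C. \<forall>z\<in>K. \<forall>j. cmod ((deriv ^^ j) g z) / (h ^ j * M j) \<le> C))}"

definition holomorphically_closed :: "(nat \<Rightarrow> real) \<Rightarrow> log_surface set \<Rightarrow> bool" where
  "holomorphically_closed M S \<longleftrightarrow>
     (\<forall>f\<in>class_A M S. \<forall>U. open U \<and> closure (f ` S) \<subseteq> U \<longrightarrow>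
       (\<forall>g. g holomorphic_on U \<longrightarrow> g \<circ> f \<in> class_A M S))"

definition inverse_closed :: "(nat \<Rightarrow> real) \<Rightarrow> log_surface set \<Rightarrow> bool" where
  "inverse_closed M S \<longleftrightarrow>
     (\<forall>f\<in>class_A M S. (INF p\<in>S. cmod (f p)) > 0 \<longrightarrow> (\<lambda>p. 1 / f p) \<in> class_A M S)"

definition composition_closed :: "(nat \<Rightarrow> real) \<Rightarrow> log_surface set \<Rightarrow> bool" where
  "composition_closed M S \<longleftrightarrow>
     (\<forall>f\<in>class_A M S. \<forall>U. open U \<and> closure (f ` S) \<subseteq> U \<longrightarrow>
       (\<forall>g\<in>class_H M U. g \<circ> f \<in> class_A M S))"

end

theory Submission
  imports Defs
begin

text \<open>Write \<open>m\<^sub>j = M\<^sub>j / j!\<close>. All the implications that produce closedness reduce to one estimate for the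
  coefficients of a composition of power series: a bound \<open>g\<^sub>\<ell> m\<^bsub>j\<^sub>1\<^esub> \<cdots> m\<^bsub>j\<^sub>\<ell>\<^esub> \<le> C h\<^sup>n m\<^sub>n\<close> over all
  compositions of \<open>n\<close> suffices; here \<open>g = 1\<close> for holomorphic outer functions and \<open>g = m\<close> for outer
  functions of the class.

  For the converse one needs a single function \<open>f\<close> in the class whose derivatives on the positive real
  axis alternate in sign and are at some point (depending on \<open>j\<close>) at least \<open>c \<gamma>\<^sup>j M\<^sub>j\<close>. It is a sum of
  dilates of a Mittag-Leffler-like kernel with \<open>j\<close>-th derivatives of size \<open>j\<^bsup>\<beta>j\<^esup>\<close>, \<open>\<beta> = \<alpha>' - 1\<close>, the
  log-convex sequence governing the dilations. Then no cancellation occurs among the Taylor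
  coefficients of \<open>1 / (b - f)\<close>, and inverse-closedness gives \<open>m\<^sub>j\<^sup>l \<le> D\<^bsup>lj\<^esup> m\<^bsub>lj\<^esub>\<close>. The indices between the
  multiples of \<open>j\<close> are reached by log-convexity.\<close>

section \<open>A kernel of Gevrey growth\<close>

text \<open>The kernel continues E(z), the integral of exp (- z s^\<beta> - s) over s > 0. Up to
  sign its j-th derivative tends to Gamma(\<beta> j + 1) at the vertex z = 0. The vertex is not a
  point of the sector, so the lower bounds are taken at real points that approach it as j grows.

  To reach |arg z| < \<alpha> \<pi> / 2 the path of s must be rotated by an angle that makes up for
  the excess of arg z over \<pi> / 2, yet stays away from \<pi> / 2 so that exp (- s) still decays.
  Such an angle exists exactly for \<beta> > \<alpha> - 1, which is why the hypothesis asks for some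
  \<alpha>' strictly larger than \<alpha>; at equality the decay is lost at the edge of the sector.

  The kernel thus accounts for the factor j^(\<beta> j) of M_j. The other factor is a log-convex
  L_j, the maximum over k of the numbers (L_k / \<mu>_k^k) \<mu>_k^j with \<mu>_k = L_(k+1) / L_k.
  Since the dilation z -> \<mu>_k z multiplies j-th derivatives by \<mu>_k^j, a sum of dilates with
  such weights produces it.\<close>

lemma open_sector: "open (sector a)"
  unfolding sector_def by (intro open_Collect_less continuous_intros)

text \<open>The natural power outside gives the value 1 at \<open>j = 0\<close> without a case
  distinction, as the convention 0^0 = 1 requires.\<close>

definition gevrey_weight :: "real \<Rightarrow> nat \<Rightarrow> real" where
  "gevrey_weight \<beta> j = (real j powr \<beta>) ^ j"

lemma gevrey_weight_pos: "gevrey_weight \<beta> j > 0"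
  by (cases j) (auto simp: gevrey_weight_def)

text \<open>The exponential is split into \<open>j\<close> equal parts, one for each factor; each
  part is handled by y \<le> exp y at y = c \<tau> / (j \<beta>).\<close>

lemma powr_exp_bound:
  fixes \<beta> c \<tau> :: real
  assumes "\<beta> > 0" "c > 0" "\<tau> \<ge> 0"
  shows "(\<tau> powr \<beta>) ^ j * exp (- (c * \<tau>)) \<le> ((\<beta> / c) powr \<beta>) ^ j * gevrey_weight \<beta> j"
proof (cases "j = 0")
  case False
  have "c * \<tau> / (real j * \<beta>) \<le> exp (c * \<tau> / (real j * \<beta>))"
    using exp_ge_add_one_self[of "c * \<tau> / (real j * \<beta>)"] by linarith
  then have "\<tau> \<le> (\<beta> / c * real j) * exp (c * \<tau> / (real j * \<beta>))"
    using assms False by (simp add: field_simps)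
  then have "\<tau> powr \<beta> \<le> ((\<beta> / c * real j) * exp (c * \<tau> / (real j * \<beta>))) powr \<beta>"
    using assms by (intro powr_mono2) auto
  also have "\<dots> = (\<beta> / c) powr \<beta> * real j powr \<beta> * exp (c * \<tau> / real j)"
    using assms False powr_mult[of "\<beta> / c" "real j" \<beta>]
      powr_mult[of "\<beta> / c * real j" "exp (c * \<tau> / (real j * \<beta>))" \<beta>]
    by (simp add: exp_powr_real)
  finally have "\<tau> powr \<beta> * exp (- (c * \<tau> / real j)) \<le> (\<beta> / c) powr \<beta> * real j powr \<beta>"
    by (simp add: exp_minus field_simps)
  then have "(\<tau> powr \<beta> * exp (- (c * \<tau> / real j))) ^ j \<le> ((\<beta> / c) powr \<beta> * real j powr \<beta>) ^ j"
    by (intro power_mono) auto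
  also have "(\<tau> powr \<beta> * exp (- (c * \<tau> / real j))) ^ j = (\<tau> powr \<beta>) ^ j * exp (- (c * \<tau>))"
    using False by (simp add: power_mult_distrib flip: exp_of_nat_mult)
  finally show ?thesis by (simp add: gevrey_weight_def power_mult_distrib)
qed (use assms in \<open>auto simp: gevrey_weight_def\<close>)

locale gevrey_kernel =
  fixes \<alpha> \<beta> :: real
  assumes \<alpha>: "\<alpha> > 1" and \<beta>: "\<beta> > \<alpha> - 1"
begin

text \<open>The rotation s = exp (- \<kappa> p) t turns e^p s^\<beta> into exp ((1 - \<kappa>
  \<beta>) p) t^\<beta>. With 1 - \<kappa> \<beta> = 1 / \<alpha> this coefficient has nonnegative
  real part on the whole sector, while the argument of exp (- \<kappa> p) stays below \<kappa>
  \<alpha> \<pi> / 2, which is less than \<pi> / 2 because \<beta> > \<alpha> - 1.\<close>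

definition \<kappa> :: real where "\<kappa> = (\<alpha> - 1) / (\<alpha> * \<beta>)"

text \<open>For real \<open>p\<close> the kernel is \<open>\<integral> s\<^bsup>\<beta> j\<^esup> exp (- e\<^sup>p s\<^bsup>\<beta>\<^esup> - s) ds\<close> over the positive half-line. The
  substitution \<open>s = exp (- \<kappa> p) t\<close>, which rotates the path by an angle depending on \<open>p\<close>, gives a
  formula valid on the whole sector, so no analytic continuation is needed. The power is written
  \<open>(t powr \<beta>) ^ j\<close> to be right at \<open>t = 0\<close>, \<open>j = 0\<close>.\<close>

definition integrand :: "nat \<Rightarrow> complex \<Rightarrow> real \<Rightarrow> complex" where
  "integrand j p t = exp (- of_real (\<kappa> * (1 + \<beta> * real j)) * p
     - exp (p / of_real \<alpha>) * of_real (t powr \<beta>) - exp (- of_real \<kappa> * p) * of_real t)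
     * of_real ((t powr \<beta>) ^ j)"

definition integrand' :: "nat \<Rightarrow> complex \<Rightarrow> real \<Rightarrow> complex" where
  "integrand' j p t = integrand j p t * (- of_real (\<kappa> * (1 + \<beta> * real j))
     - exp (p / of_real \<alpha>) * of_real (t powr \<beta>) / of_real \<alpha>
     + of_real \<kappa> * exp (- of_real \<kappa> * p) * of_real t)"

lemma \<beta>_pos: "\<beta> > 0" and \<kappa>_pos: "\<kappa> > 0" and \<kappa>_\<beta>: "\<kappa> * \<beta> = 1 - 1 / \<alpha>"
  using \<alpha> \<beta> by (auto simp: \<kappa>_def field_simps)

lemma \<kappa>_\<alpha>: "\<kappa> * \<alpha> < 1"
proof -
  have "\<kappa> * \<alpha> = (\<alpha> - 1) / \<beta>" using \<alpha> by (simp add: \<kappa>_def)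
  then show ?thesis using \<beta> \<beta>_pos by simp
qed

lemma integrand_deriv:
  "((\<lambda>p. integrand j p t) has_field_derivative integrand' j p t) (at p within A)"
  unfolding integrand_def integrand'_def
  by (rule derivative_eq_intros refl | use \<alpha> in simp)+

lemma continuous_powr_\<beta>: "continuous_on (UNIV \<times> {0..}) (\<lambda>x. snd x powr \<beta>)"
  using \<beta>_pos by (intro continuous_on_powr' continuous_on_snd continuous_on_id continuous_on_const) auto

lemma continuous_integrand:
  "continuous_on (UNIV \<times> {0..}) (\<lambda>x. integrand j (fst x) (snd x))"
  unfolding integrand_def divide_inverse
  by (intro continuous_on_mult continuous_on_exp continuous_on_diff continuous_on_of_real
      continuous_on_power continuous_powr_\<beta> continuous_on_const continuous_on_fst continuous_on_snd
      continuous_on_id)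

lemma continuous_integrand':
  "continuous_on (UNIV \<times> {0..}) (\<lambda>(p, t). integrand' j p t)"
  unfolding integrand'_def divide_inverse split_beta
  by (intro continuous_on_mult continuous_on_exp continuous_on_diff continuous_on_add continuous_on_of_real
      continuous_integrand continuous_powr_\<beta> continuous_on_const continuous_on_fst continuous_on_snd
      continuous_on_id)

lemma continuous_integrand_t:
  assumes "0 \<le> a"
  shows "continuous_on {a..b} (integrand j p)"
proof -
  have "continuous_on {a..b} (\<lambda>t. (p, t))"
    by (intro continuous_on_Pair continuous_on_const continuous_on_id)
  from continuous_on_compose2[OF continuous_integrand this] assms show ?thesis
    by (auto simp: image_subset_iff)
qed

lemma integrand_Suc:
  "exp (p / of_real \<alpha>) * of_real (t powr \<beta>) * integrand j p t = exp p * integrand (Suc j) p t"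
proof -
  have "exp (p / of_real \<alpha>) * exp (- of_real (\<kappa> * (1 + \<beta> * real j)) * p) =
        exp p * exp (- of_real (\<kappa> * (1 + \<beta> * real (Suc j))) * p)"
  proof -
    have "p / of_real \<alpha> = p + of_real (1 / \<alpha> - 1) * p"
      by (simp add: algebra_simps)
    also have "1 / \<alpha> - 1 = - \<kappa> * \<beta>" using \<kappa>_\<beta> by simp
    finally have *: "p / of_real \<alpha> = p + of_real (- \<kappa> * \<beta>) * p" .
    show ?thesis unfolding exp_add[symmetric] *
      by (simp add: algebra_simps)
  qed
  then show ?thesis
    unfolding integrand_def exp_diff by (simp add: mult_ac)
qed

text \<open>The choice of \<^term>\<open>\<kappa>\<close> makes \<open>\<partial>\<^sub>p \<Phi>\<^sub>j + e\<^sup>p \<Phi>\<^bsub>j+1\<^esub>\<close>, where \<open>\<Phi>\<close> is the integrand, a total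
  derivative in \<open>t\<close>. Hence \<open>\<partial>\<^sub>p\<close> maps the \<open>j\<close>-th kernel to \<open>- e\<^sup>p\<close> times the next one.\<close>

lemma integrand_parts:
  assumes "t > 0"
  shows "((\<lambda>t. - of_real \<kappa> * of_real t * integrand j p t) has_vector_derivative
           (integrand' j p t + exp p * integrand (Suc j) p t)) (at t)"
proof -
  let ?B = "exp (p / of_real \<alpha>)" and ?C = "exp (- of_real \<kappa> * p)"
  let ?A = "- of_real (\<kappa> * (1 + \<beta> * real j)) * p"
  have pw: "(t powr \<beta>) ^ j = t powr (\<beta> * real j)" if "t > 0" for t
    using that by (simp add: powr_powr flip: powr_realpow)
  have "((\<lambda>t. t powr (1 + \<beta> * real j)) has_field_derivative
           (1 + \<beta> * real j) * t powr (\<beta> * real j)) (at t)"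
    using assms by (auto intro!: derivative_eq_intros)
  moreover have "\<forall>\<^sub>F t in nhds t. t powr (1 + \<beta> * real j) = t * (t powr \<beta>) ^ j"
    using eventually_nhds_in_open[of "{0<..}" t] assms
    by (auto elim!: eventually_mono simp: pw powr_add)
  ultimately have 1: "((\<lambda>t. t * (t powr \<beta>) ^ j) has_field_derivative
      (1 + \<beta> * real j) * (t powr \<beta>) ^ j) (at t)"
    using assms by (simp add: pw DERIV_cong_ev)
  have 2: "((\<lambda>t. t powr \<beta>) has_field_derivative \<beta> * t powr \<beta> / t) (at t)"
    using assms by (auto intro!: derivative_eq_intros simp: powr_diff)
  have "((\<lambda>t. ?A - ?B * of_real (t powr \<beta>) - ?C * of_real t) has_vector_derivative
      - ?B * of_real (\<beta> * t powr \<beta> / t) - ?C) (at t)"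
    using has_vector_derivative_diff[OF has_vector_derivative_diff[OF has_vector_derivative_const
        has_vector_derivative_mult_right[OF has_vector_derivative_of_real[OF 2]]]
        has_vector_derivative_mult_right[OF has_vector_derivative_of_real[OF DERIV_ident]],
        of ?A ?B ?C] by simp
  then have "((\<lambda>t. exp (?A - ?B * of_real (t powr \<beta>) - ?C * of_real t)) has_vector_derivative
      (- ?B * of_real (\<beta> * t powr \<beta> / t) - ?C) * exp (?A - ?B * of_real (t powr \<beta>) - ?C * of_real t)) (at t)"
    by (rule field_vector_diff_chain_at[unfolded o_def]) (rule DERIV_exp)
  note 3 = has_vector_derivative_mult[OF has_vector_derivative_of_real[OF 1] this]
  have 4: "((\<lambda>t. of_real t * integrand j p t) has_vector_derivative
      (1 + of_real (\<beta> * real j) - of_real \<beta> * (?B * of_real (t powr \<beta>)) - ?C * of_real t) * integrand j p t) (at t)"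
    using 3 assms unfolding integrand_def
    by (simp add: algebra_simps)
  have "((\<lambda>t. - of_real \<kappa> * (of_real t * integrand j p t)) has_vector_derivative
      - of_real \<kappa> * ((1 + of_real (\<beta> * real j) - of_real \<beta> * (?B * of_real (t powr \<beta>)) - ?C * of_real t) * integrand j p t)) (at t)"
    by (intro has_vector_derivative_mult_right 4)
  also have "- of_real \<kappa> * ((1 + of_real (\<beta> * real j) - of_real \<beta> * (?B * of_real (t powr \<beta>)) - ?C * of_real t) * integrand j p t)
     = integrand' j p t + (of_real (\<kappa> * \<beta>) + 1 / of_real \<alpha>) * (?B * of_real (t powr \<beta>)  * integrand j p t)"
    unfolding integrand'_def by (simp add: algebra_simps)
  also have "of_real (\<kappa> * \<beta>) + 1 / of_real \<alpha> = (1 :: complex)"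
    by (simp add: \<kappa>_\<beta>)
  finally show ?thesis by (simp add: integrand_Suc [symmetric] mult.assoc)
qed

section \<open>Convergence, bounds and derivative of the kernel\<close>

definition truncated_kernel :: "nat \<Rightarrow> real \<Rightarrow> complex \<Rightarrow> complex" where
  "truncated_kernel j T p = integral {0..T} (integrand j p)"

text \<open>At fixed s the derivative in p would be just - e^p times the next integrand. The path
  moves with p, at velocity - \<kappa> s, and this motion contributes the boundary term at
  \<open>T\<close>.\<close>

lemma truncated_kernel_deriv:
  assumes "T \<ge> 0"
  shows "(truncated_kernel j T has_field_derivative
     - of_real (\<kappa> * T) * integrand j p T - exp p * truncated_kernel (Suc j) T p) (at p)"
proof -
  have "((\<lambda>p. integral (cbox 0 T) (integrand j p)) has_field_derivative
      integral (cbox 0 T) (integrand' j p)) (at p within UNIV)"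
  proof (rule leibniz_rule_field_derivative[OF integrand_deriv])
    show "integrand j x integrable_on cbox 0 T" for x
      using integrable_continuous_real[OF continuous_integrand_t] by simp
    show "continuous_on (UNIV \<times> cbox 0 T) (\<lambda>(x, t). integrand' j x t)"
      by (rule continuous_on_subset[OF continuous_integrand']) auto
  qed auto
  then have *: "(truncated_kernel j T has_field_derivative integral {0..T} (integrand' j p)) (at p)"
    unfolding truncated_kernel_def by simp
  \<comment> \<open>At t = 0 the power \<open>t powr \<beta>\<close> need not be differentiable, so
    the primitive is differentiated in the open interval only; it vanishes at 0.\<close>
  have "((\<lambda>t. integrand' j p t + exp p * integrand (Suc j) p t) has_integral
     (- of_real \<kappa> * of_real T * integrand j p T - (- of_real \<kappa> * of_real 0 * integrand j p 0))) {0..T}"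
    by (intro fundamental_theorem_of_calculus_interior assms integrand_parts continuous_intros
         continuous_integrand_t) auto
  moreover have "((\<lambda>t. exp p * integrand (Suc j) p t) has_integral exp p * truncated_kernel (Suc j) T p) {0..T}"
    unfolding truncated_kernel_def
    by (intro has_integral_mult_right integrable_integral integrable_continuous_real
         continuous_integrand_t) auto
  ultimately have "((\<lambda>t. integrand' j p t + exp p * integrand (Suc j) p t - exp p * integrand (Suc j) p t) has_integral
     (- of_real \<kappa> * of_real T * integrand j p T - (- of_real \<kappa> * of_real 0 * integrand j p 0) - exp p * truncated_kernel (Suc j) T p)) {0..T}"
    by (rule has_integral_diff)
  then have "integral {0..T} (integrand' j p) = - of_real (\<kappa> * T) * integrand j p T - exp p * truncated_kernel (Suc j) T p"
    by (simp add: integral_unique)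
  with * show ?thesis by simp
qed

text \<open>cos (\<kappa> \<alpha> \<pi> / 2) bounds cos (\<kappa> Im p) from below on the sector.
  Half of the resulting decay is spent on the power of t, the other half is kept for the
  integration.\<close>

definition c\<^sub>0 :: real where "c\<^sub>0 = cos (\<kappa> * \<alpha> * pi / 2) / 2"

definition kernel_bound :: "nat \<Rightarrow> real" where "kernel_bound j = ((\<beta> / c\<^sub>0) powr \<beta>) ^ j * gevrey_weight \<beta> j"

lemma c\<^sub>0_pos: "c\<^sub>0 > 0"
proof -
  have "\<kappa> * \<alpha> * pi / 2 < pi / 2" "0 < \<kappa> * \<alpha> * pi / 2"
    using \<kappa>_\<alpha> \<kappa>_pos \<alpha> by auto
  then show ?thesis unfolding c\<^sub>0_def using cos_gt_zero_pi[of "\<kappa> * \<alpha> * pi / 2"] by linarith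
qed

lemma kernel_bound_nonneg: "kernel_bound j \<ge> 0"
  using gevrey_weight_pos[of \<beta> j] by (simp add: kernel_bound_def)

text \<open>\<open>r\<close> is the modulus of exp (- \<kappa> p), so the prefactor has modulus r^(1
  + \<beta> j). The part r^(\<beta> j) turns t^(\<beta> j) into (r t)^(\<beta> j), and the remaining
  r makes the integral over t independent of p: the final bound is uniform on the sector.\<close>

lemma norm_integrand_le:
  assumes p: "p \<in> sector \<alpha>" and t: "t \<ge> 0"
  defines "r \<equiv> exp (- \<kappa> * Re p)"
  shows "norm (integrand j p t) \<le> kernel_bound j * (r * exp (- (c\<^sub>0 * r * t)))"
proof -
  have im: "\<bar>Im p\<bar> < \<alpha> * pi / 2" using p by (simp add: sector_def)
  have "\<bar>Im p / \<alpha>\<bar> = \<bar>Im p\<bar> / \<alpha>" using \<alpha> by simp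
  also have "\<dots> < pi / 2" using im \<alpha> by (simp add: field_simps)
  finally have "cos (Im p / \<alpha>) \<ge> 0" by (intro cos_ge_zero) linarith+
  then have 1: "Re (exp (p / of_real \<alpha>)) \<ge> 0"
    by (simp add: Re_exp)
  have "\<bar>\<kappa> * Im p\<bar> \<le> \<kappa> * \<alpha> * pi / 2"
    using im \<kappa>_pos by (simp add: abs_mult)
  moreover have "\<kappa> * \<alpha> * pi / 2 \<le> pi" using \<kappa>_\<alpha> by (simp add: order.strict_implies_order mult_left_le_one_le)
  ultimately have "cos (\<kappa> * \<alpha> * pi / 2) \<le> cos \<bar>\<kappa> * Im p\<bar>"
    by (intro cos_monotone_0_pi_le) auto
  then have "2 * c\<^sub>0 \<le> cos (\<kappa> * Im p)" by (simp add: c\<^sub>0_def)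
  then have 2: "Re (exp (- of_real \<kappa> * p)) \<ge> 2 * c\<^sub>0 * r"
    by (simp add: Re_exp r_def mult.commute)
  have r: "r > 0" by (simp add: r_def)
  have "norm (integrand j p t) = exp (- (\<kappa> * (1 + \<beta> * real j)) * Re p
       - Re (exp (p / of_real \<alpha>)) * (t powr \<beta>) - Re (exp (- of_real \<kappa> * p)) * t) * (t powr \<beta>) ^ j"
    unfolding integrand_def by (simp add: norm_mult norm_power)
  also have "\<dots> \<le> exp (- (\<kappa> * (1 + \<beta> * real j)) * Re p - 2 * c\<^sub>0 * r * t) * (t powr \<beta>) ^ j"
  proof (rule mult_right_mono)
    have "- (\<kappa> * (1 + \<beta> * real j)) * Re p - Re (exp (p / of_real \<alpha>)) * (t powr \<beta>)
        - Re (exp (- of_real \<kappa> * p)) * t \<le> - (\<kappa> * (1 + \<beta> * real j)) * Re p - 2 * c\<^sub>0 * r * t"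
      using mult_nonneg_nonneg[OF 1 powr_ge_zero[of t \<beta>]] mult_right_mono[OF 2 t] by argo
    then show "exp (- (\<kappa> * (1 + \<beta> * real j)) * Re p - Re (exp (p / of_real \<alpha>)) * (t powr \<beta>)
        - Re (exp (- of_real \<kappa> * p)) * t) \<le> exp (- (\<kappa> * (1 + \<beta> * real j)) * Re p - 2 * c\<^sub>0 * r * t)"
      by (simp only: exp_le_cancel_iff)
  qed simp
  also have "exp (- (\<kappa> * (1 + \<beta> * real j)) * Re p - 2 * c\<^sub>0 * r * t) =
     r * (r powr \<beta>) ^ j * (exp (- (c\<^sub>0 * (r * t))) * exp (- (c\<^sub>0 * r * t)))"
    by (simp add: r_def exp_powr_real algebra_simps flip: exp_add exp_of_nat_mult)
  also have "\<dots> * (t powr \<beta>) ^ j = (((r * t) powr \<beta>) ^ j * exp (- (c\<^sub>0 * (r * t)))) * (r * exp (- (c\<^sub>0 * r * t)))"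
    using r t by (simp add: powr_mult power_mult_distrib)
  also have "\<dots> \<le> kernel_bound j * (r * exp (- (c\<^sub>0 * r * t)))"
    unfolding kernel_bound_def using r t c\<^sub>0_pos \<beta>_pos by (intro mult_right_mono powr_exp_bound) auto
  finally show ?thesis .
qed

lemma integrand_integrable: "0 \<le> a \<Longrightarrow> integrand j p integrable_on {a..b}"
  by (intro integrable_continuous_real continuous_integrand_t)

lemma norm_truncated_kernel_diff_le:
  assumes p: "p \<in> sector \<alpha>" and "0 \<le> S" "S \<le> T"
  defines "r \<equiv> exp (- \<kappa> * Re p)"
  shows "norm (truncated_kernel j T p - truncated_kernel j S p) \<le> kernel_bound j / c\<^sub>0 * exp (- (c\<^sub>0 * r * S))"
proof -
  have r: "r > 0" by (simp add: r_def)
  have "truncated_kernel j T p - truncated_kernel j S p = integral {S..T} (integrand j p)"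
    unfolding truncated_kernel_def using assms
    by (subst Henstock_Kurzweil_Integration.integral_combine[of 0 S T, symmetric]) (auto intro: integrand_integrable)
  also have hi: "((\<lambda>t. kernel_bound j * (r * exp (- (c\<^sub>0 * r * t)))) has_integral
      (- kernel_bound j / c\<^sub>0 * exp (- (c\<^sub>0 * r * T)) - (- kernel_bound j / c\<^sub>0 * exp (- (c\<^sub>0 * r * S))))) {S..T}"
    using c\<^sub>0_pos assms
    by (intro fundamental_theorem_of_calculus) (auto intro!: derivative_eq_intros simp flip: has_real_derivative_iff_has_vector_derivative)
  have "norm (integral {S..T} (integrand j p)) \<le> integral {S..T} (\<lambda>t. kernel_bound j * (r * exp (- (c\<^sub>0 * r * t))))"
    using assms unfolding r_def
    by (intro Henstock_Kurzweil_Integration.integral_norm_bound_integral integrand_integrable norm_integrand_le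
         has_integral_integrable[OF hi[unfolded r_def]]) auto
  also have "\<dots> = kernel_bound j / c\<^sub>0 * exp (- (c\<^sub>0 * r * S)) - kernel_bound j / c\<^sub>0 * exp (- (c\<^sub>0 * r * T))"
    using integral_unique[OF hi] by simp
  also have "\<dots> \<le> kernel_bound j / c\<^sub>0 * exp (- (c\<^sub>0 * r * S))"
    using kernel_bound_nonneg c\<^sub>0_pos by simp
  finally show ?thesis .
qed

definition kernel :: "nat \<Rightarrow> complex \<Rightarrow> complex" where
  "kernel j p = lim (\<lambda>n. truncated_kernel j (real n) p)"

text \<open>The tail bound exp (- c r S) degenerates as Re p grows, since r = exp (- \<kappa> Re p)
  then tends to 0. Uniformity on left parts of the sector is enough for differentiation, which is
  local.\<close>

lemma kernel_uniform_limit: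
  "uniform_limit {p \<in> sector \<alpha>. Re p \<le> R} (\<lambda>n. truncated_kernel j (real n)) (kernel j) sequentially"
  unfolding kernel_def uniformly_convergent_uniform_limit_iff[symmetric]
proof (intro Cauchy_uniformly_convergent uniformly_Cauchy_onI')
  fix e :: real assume e: "e > 0"
  define q where "q = exp (- (c\<^sub>0 * exp (- \<kappa> * R)))"
  have "(\<lambda>n. kernel_bound j / c\<^sub>0 * q ^ n) \<longlonglongrightarrow> kernel_bound j / c\<^sub>0 * 0"
    using c\<^sub>0_pos by (intro tendsto_mult_left LIMSEQ_power_zero) (simp add: q_def)
  then have "\<forall>\<^sub>F n in sequentially. kernel_bound j / c\<^sub>0 * q ^ n < e"
    using e by (auto simp: order_tendsto_iff)
  then obtain N where N: "\<And>n. n \<ge> N \<Longrightarrow> kernel_bound j / c\<^sub>0 * q ^ n < e"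
    by (auto simp: eventually_sequentially)
  have "dist (truncated_kernel j (real m) x) (truncated_kernel j (real n) x) < e"
    if x: "x \<in> {p \<in> sector \<alpha>. Re p \<le> R}" and mn: "m \<ge> N" "n > m" for x m n
  proof -
    have "dist (truncated_kernel j (real m) x) (truncated_kernel j (real n) x)
        \<le> kernel_bound j / c\<^sub>0 * exp (- (c\<^sub>0 * exp (- \<kappa> * Re x) * real m))"
      using norm_truncated_kernel_diff_le[of x "real m" "real n" j] x mn by (simp add: dist_norm norm_minus_commute)
    also have "\<dots> \<le> kernel_bound j / c\<^sub>0 * exp (- (c\<^sub>0 * exp (- \<kappa> * R) * real m))"
      using c\<^sub>0_pos kernel_bound_nonneg \<kappa>_pos x by (intro mult_left_mono) (auto intro!: mult_right_mono)
    also have "\<dots> = kernel_bound j / c\<^sub>0 * q ^ m"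
      unfolding q_def by (simp add: mult_ac flip: exp_of_nat_mult)
    also have "\<dots> < e" using N mn by simp
    finally show ?thesis .
  qed
  then show "\<exists>M. \<forall>x\<in>{p \<in> sector \<alpha>. Re p \<le> R}. \<forall>m\<ge>M. \<forall>n>m.
      dist (truncated_kernel j (real m) x) (truncated_kernel j (real n) x) < e" by blast
qed

lemma kernel_tendsto:
  assumes "p \<in> sector \<alpha>"
  shows "(\<lambda>n. truncated_kernel j (real n) p) \<longlonglongrightarrow> kernel j p"
  using tendsto_uniform_limitI[OF kernel_uniform_limit[of j "Re p"], of p] assms by simp

lemma norm_kernel_le:
  assumes "p \<in> sector \<alpha>"
  shows "norm (kernel j p) \<le> kernel_bound j / c\<^sub>0"
proof (rule Lim_bounded)
  show "(\<lambda>n. norm (truncated_kernel j (real n) p)) \<longlonglongrightarrow> norm (kernel j p)"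
    by (intro tendsto_norm kernel_tendsto assms)
  show "\<forall>n\<ge>0. norm (truncated_kernel j (real n) p) \<le> kernel_bound j / c\<^sub>0"
    using norm_truncated_kernel_diff_le[OF assms, of 0 _ j] by (auto simp: truncated_kernel_def)
qed

lemma kernel_deriv:
  assumes p: "p \<in> sector \<alpha>"
  shows "(kernel j has_field_derivative - exp p * kernel (Suc j) p) (at p)"
proof -
  have "\<exists>g'. \<forall>p\<in>sector \<alpha>. (kernel j has_field_derivative g' p) (at p) \<and>
     (\<lambda>n. - of_real (\<kappa> * real n) * integrand j p (real n) - exp p * truncated_kernel (Suc j) (real n) p) \<longlonglongrightarrow> g' p"
  proof (rule has_complex_derivative_uniform_sequence[OF open_sector truncated_kernel_deriv])
    fix x assume "x \<in> sector \<alpha>"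
    then obtain d where d: "d > 0" "cball x d \<subseteq> sector \<alpha>"
      using open_sector open_contains_cball by metis
    have "Re y \<le> Re x + d" if "y \<in> cball x d" for y
      using that complex_Re_le_cmod[of "y - x"] by (simp add: dist_norm norm_minus_commute)
    then have "cball x d \<subseteq> {p \<in> sector \<alpha>. Re p \<le> Re x + d}" using d by auto
    then show "\<exists>d. 0 < d \<and> cball x d \<subseteq> sector \<alpha> \<and>
        uniform_limit (cball x d) (\<lambda>n. truncated_kernel j (real n)) (kernel j) sequentially"
      using d uniform_limit_on_subset[OF kernel_uniform_limit] by blast
  qed auto
  then obtain g' where g': "(kernel j has_field_derivative g') (at p)"
     "(\<lambda>n. - of_real (\<kappa> * real n) * integrand j p (real n) - exp p * truncated_kernel (Suc j) (real n) p) \<longlonglongrightarrow> g'"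
    using p by blast
  define r where "r = exp (- \<kappa> * Re p)"
  define q where "q = exp (- (c\<^sub>0 * r))"
  \<comment> \<open>The boundary term caused by the moving path disappears in the limit, being
    dominated by a multiple of n q^n with q < 1.\<close>
  have "(\<lambda>n. - of_real (\<kappa> * real n) * integrand j p (real n)) \<longlonglongrightarrow> 0"
  proof (rule Lim_null_comparison)
    show "\<forall>\<^sub>F n in sequentially. norm (- of_real (\<kappa> * real n) * integrand j p (real n))
        \<le> \<kappa> * kernel_bound j * r * (real n * q ^ n)"
    proof (intro always_eventually allI)
      fix n
      have "norm (- of_real (\<kappa> * real n) * integrand j p (real n)) =
         \<kappa> * real n * norm (integrand j p (real n))"
        using \<kappa>_pos by (simp add: norm_mult)
      also have "\<dots> \<le> \<kappa> * real n * (kernel_bound j * (r * exp (- (c\<^sub>0 * r * real n))))"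
        unfolding r_def using \<kappa>_pos p by (intro mult_left_mono norm_integrand_le) auto
      also have "exp (- (c\<^sub>0 * r * real n)) = q ^ n"
        unfolding q_def by (simp add: mult_ac flip: exp_of_nat_mult)
      finally show "norm (- of_real (\<kappa> * real n) * integrand j p (real n))
        \<le> \<kappa> * kernel_bound j * r * (real n * q ^ n)" by (simp add: mult_ac)
    qed
    have "(\<lambda>n. \<kappa> * kernel_bound j * r * (real n * q ^ n)) \<longlonglongrightarrow> \<kappa> * kernel_bound j * r * 0"
      using c\<^sub>0_pos by (intro tendsto_mult_left powser_times_n_limit_0) (simp add: q_def r_def)
    then show "(\<lambda>n. \<kappa> * kernel_bound j * r * (real n * q ^ n)) \<longlonglongrightarrow> 0" by simp
  qed
  from tendsto_diff[OF this tendsto_mult_left[OF kernel_tendsto[OF p]]]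
  have "(\<lambda>n. - of_real (\<kappa> * real n) * integrand j p (real n) - exp p * truncated_kernel (Suc j) (real n) p)
     \<longlonglongrightarrow> - exp p * kernel (Suc j) p" by simp
  with g' show ?thesis using LIMSEQ_unique by blast
qed

section \<open>The kernel on the positive real axis\<close>

lemma of_real_in_sector: "of_real x \<in> sector \<alpha>"
  using \<alpha> by (simp add: sector_def)

definition integrand_real :: "nat \<Rightarrow> real \<Rightarrow> real \<Rightarrow> real" where
  "integrand_real j x t = exp (- (\<kappa> * (1 + \<beta> * real j)) * x
     - exp (x / \<alpha>) * t powr \<beta> - exp (- \<kappa> * x) * t) * (t powr \<beta>) ^ j"

lemma integrand_of_real: "integrand j (of_real x) t = of_real (integrand_real j x t)"
  unfolding integrand_def integrand_real_def
  by (simp flip: exp_of_real)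

lemma integrand_real_integrable:
  "0 \<le> a \<Longrightarrow> integrand_real j x integrable_on {a..b}"
  using continuous_on_Re[OF continuous_integrand_t[of a b j "of_real x"]]
  by (intro integrable_continuous_real) (simp add: integrand_of_real)

lemma truncated_kernel_of_real:
  "truncated_kernel j T (of_real x) = of_real (integral {0..T} (integrand_real j x))"
  unfolding truncated_kernel_def integrand_of_real
  by (intro integral_unique has_integral_of_real integrable_integral integrand_real_integrable) simp

text \<open>For real p the integrand is nonnegative, so the truncated integrals increase to the
  kernel and each of them is a lower bound.\<close>

lemma kernel_of_real_ge:
  assumes "T \<ge> 0"
  shows "kernel j (of_real x) \<in> \<real> \<and> Re (kernel j (of_real x)) \<ge> integral {0..T} (integrand_real j x)"
proof
  note lim = kernel_tendsto[OF of_real_in_sector, of j x]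
  show "kernel j (of_real x) \<in> \<real>"
    by (rule closed_sequentially[OF closed_complex_Reals _ lim]) (simp add: truncated_kernel_of_real)
  have "(\<lambda>n. Re (truncated_kernel j (real n) (of_real x))) \<longlonglongrightarrow> Re (kernel j (of_real x))"
    by (intro tendsto_Re lim)
  then show "Re (kernel j (of_real x)) \<ge> integral {0..T} (integrand_real j x)"
  proof (rule tendsto_lowerbound)
    have "integral {0..T} (integrand_real j x) \<le> Re (truncated_kernel j (real n) (of_real x))"
      if "real n \<ge> T" for n
      unfolding truncated_kernel_of_real Re_complex_of_real using that assms
      by (intro integral_subset_le integrand_real_integrable) (auto simp: integrand_real_def)
    then show "\<forall>\<^sub>F n in sequentially. integral {0..T} (integrand_real j x) \<le> Re (truncated_kernel j (real n) (of_real x))"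
      using eventually_ge_at_top[of "nat \<lceil>T\<rceil>"] by (auto elim!: eventually_mono simp: nat_le_iff ceiling_le_iff)
  qed simp
qed

lemma kernel_lower_bound:
  "\<exists>x::real. Re (kernel j (of_real x)) \<ge> exp (-3) * exp (-2) ^ j * gevrey_weight \<beta> j"
proof -
  \<comment> \<open>\<open>J\<close> replaces \<open>j\<close> so that the interval from J to 2 J is
    nondegenerate also for \<open>j = 0\<close>; J^(\<beta> j) is the weight in both cases.\<close>
  define J :: real where "J = max 1 (real j)"
  have J: "J \<ge> 1" "J \<le> 1 + real j" by (auto simp: J_def)
  \<comment> \<open>In the variable s = r t, the value e^x = (2 J)^(- \<beta>) keeps e^x s^\<beta>
    \<le> 1 for s \<le> 2 J. On J \<le> s \<le> 2 J the power is then at least J^(\<beta> j) and the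
    exponential at least exp (- 1 - 2 J) \<ge> exp (- 3 - 2 j).\<close>
  define x where "x = - \<beta> * ln (2 * J)"
  define r where "r = exp (- \<kappa> * x)"
  have r: "r > 0" by (simp add: r_def)
  have ex: "exp x * (2 * J) powr \<beta> = 1"
    using J unfolding x_def powr_def by (simp flip: exp_add)
  have gevrey_weight: "gevrey_weight \<beta> j = (J powr \<beta>) ^ j"
    by (cases j) (auto simp: gevrey_weight_def J_def)
  let ?C = "r * exp (- 3 - 2 * real j) * gevrey_weight \<beta> j"
  have lower: "?C \<le> integrand_real j x t" if t: "t \<in> {J / r..2 * J / r}" for t
  proof -
    have t0: "t > 0" using t J r by (smt (verit) atLeastAtMost_iff divide_pos_pos)
    have rt: "J \<le> r * t" "r * t \<le> 2 * J" using t r by (auto simp: field_simps)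
    have "exp (x / \<alpha>) = exp x * r powr \<beta>"
    proof -
      have "x / \<alpha> = x + (- \<kappa> * x) * \<beta>"
      proof -
        have "(- \<kappa> * x) * \<beta> = - x * (\<kappa> * \<beta>)" by simp
        then show ?thesis unfolding \<kappa>_\<beta> by (simp add: algebra_simps)
      qed
      then show ?thesis unfolding r_def by (simp add: exp_powr_real flip: exp_add)
    qed
    then have "exp (x / \<alpha>) * t powr \<beta> = exp x * (r * t) powr \<beta>"
      using r t0 by (simp add: powr_mult)
    also have "\<dots> \<le> exp x * (2 * J) powr \<beta>"
      using rt J \<beta>_pos r t0 by (intro mult_left_mono powr_mono2) auto
    finally have 1: "exp (x / \<alpha>) * t powr \<beta> \<le> 1" by (simp add: ex)
    have "exp (- 3 - 2 * real j) * gevrey_weight \<beta> j \<le>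
        exp (- exp (x / \<alpha>) * t powr \<beta> - r * t) * ((r * t) powr \<beta>) ^ j"
      unfolding gevrey_weight
    proof (intro mult_mono)
      show "exp (- 3 - 2 * real j) \<le> exp (- exp (x / \<alpha>) * t powr \<beta> - r * t)"
        using 1 rt J by simp
      show "(J powr \<beta>) ^ j \<le> ((r * t) powr \<beta>) ^ j"
        using rt J \<beta>_pos by (intro power_mono powr_mono2) auto
    qed auto
    then have "?C \<le> r * (exp (- exp (x / \<alpha>) * t powr \<beta> - r * t) * ((r * t) powr \<beta>) ^ j)"
      using r by (simp add: mult.assoc)
    also have "\<dots> = r * (r powr \<beta>) ^ j * exp (- exp (x / \<alpha>) * t powr \<beta> - r * t) * (t powr \<beta>) ^ j"
      using r t0 by (simp add: powr_mult power_mult_distrib)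
    also have "r * (r powr \<beta>) ^ j = exp (- (\<kappa> * (1 + \<beta> * real j)) * x)"
      by (simp add: r_def exp_powr_real algebra_simps flip: exp_add exp_of_nat_mult)
    also have "exp (- (\<kappa> * (1 + \<beta> * real j)) * x) * exp (- exp (x / \<alpha>) * t powr \<beta> - r * t) * (t powr \<beta>) ^ j
        = integrand_real j x t"
      unfolding integrand_real_def r_def by (simp add: algebra_simps flip: exp_add)
    finally show ?thesis .
  qed
  have "exp (-3) * exp (-2) ^ j * gevrey_weight \<beta> j = exp (- 3 - 2 * real j) * gevrey_weight \<beta> j"
    by (simp add: exp_diff exp_minus power_inverse divide_inverse flip: exp_of_nat2_mult exp_of_nat_mult)
  also have "\<dots> \<le> J * (exp (- 3 - 2 * real j) * gevrey_weight \<beta> j)"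
    using mult_right_mono[OF J(1), of "exp (- 3 - 2 * real j) * gevrey_weight \<beta> j"] gevrey_weight_pos[of \<beta> j] by simp
  also have "\<dots> = integral {J / r..2 * J / r} (\<lambda>t. ?C)"
    using r J by (simp add: field_simps)
  also have "\<dots> \<le> integral {J / r..2 * J / r} (integrand_real j x)"
    using lower r J by (intro integral_le integrand_real_integrable) auto
  also have "\<dots> \<le> integral {0..2 * J / r} (integrand_real j x)"
    using r J by (intro integral_subset_le integrand_real_integrable) (auto simp: integrand_real_def intro: order_trans[rotated])
  also have "\<dots> \<le> Re (kernel j (of_real x))"
    using kernel_of_real_ge[of "2 * J / r" j x] r J by simp
  finally show ?thesis by blast
qed

lemma kernel_of_real:
  "kernel j (of_real x) \<in> \<real>" "Re (kernel j (of_real x)) \<ge> 0"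
  using kernel_of_real_ge[of 0 j x] by auto

end

section \<open>Extremal functions\<close>

definition ratio_seq :: "(nat \<Rightarrow> real) \<Rightarrow> nat \<Rightarrow> real" where
  "ratio_seq L k = L (Suc k) / L k"

lemma log_convex_pos: "log_convex_seq L \<Longrightarrow> L j > 0"
  by (simp add: log_convex_seq_def positive_seq_def)

lemma ratio_seq_pos: "log_convex_seq L \<Longrightarrow> ratio_seq L k > 0"
  by (simp add: ratio_seq_def log_convex_pos)

lemma incseq_ratio_seq:
  assumes "log_convex_seq L"
  shows "incseq (ratio_seq L)"
proof (rule incseq_SucI)
  fix n
  have "(L (Suc n))\<^sup>2 \<le> L (Suc n - 1) * L (Suc n + 1)"
    using assms unfolding log_convex_seq_def by (metis le_add1 plus_1_eq_Suc)
  then show "ratio_seq L n \<le> ratio_seq L (Suc n)"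
    using log_convex_pos[OF assms, of n] log_convex_pos[OF assms, of "Suc n"]
    by (simp add: ratio_seq_def field_simps power2_eq_square)
qed

text \<open>The graph of the convex function log L lies above its supporting line at k of slope log
  \<mu>_k; \<open>up\<close> treats the indices to the right of k, \<open>down\<close> those to the
  left.\<close>

lemma log_convex_ratio_power_le:
  assumes L: "log_convex_seq L"
  shows "ratio_seq L k ^ j * L k \<le> L j * ratio_seq L k ^ k"
proof -
  note pos = ratio_seq_pos[OF L] log_convex_pos[OF L]
  have up: "ratio_seq L k ^ n * L k \<le> L (k + n)" for n
  proof (induction n)
    case (Suc n)
    have "ratio_seq L k ^ Suc n * L k \<le> ratio_seq L k * L (k + n)"
      using Suc pos[of k] by (simp add: mult.assoc)
    also have "\<dots> \<le> ratio_seq L (k + n) * L (k + n)"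
      using incseqD[OF incseq_ratio_seq[OF L], of k "k + n"] pos(2)[of "k + n"] by simp
    also have "\<dots> = L (k + Suc n)" using pos(2)[of "k + n"] by (simp add: ratio_seq_def)
    finally show ?case .
  qed simp
  have down: "L (i + n) \<le> L i * ratio_seq L (i + n) ^ n" for i n
  proof (induction n)
    case (Suc n)
    have "L (i + Suc n) = L (i + n) * ratio_seq L (i + n)"
      using pos(2)[of "i + n"] by (simp add: ratio_seq_def)
    also have "\<dots> \<le> L i * ratio_seq L (i + n) ^ n * ratio_seq L (i + n)"
      using Suc pos(1)[of "i + n"] by simp
    also have "\<dots> = L i * ratio_seq L (i + n) ^ Suc n" by simp
    also have "\<dots> \<le> L i * ratio_seq L (i + Suc n) ^ Suc n"
      using incseqD[OF incseq_ratio_seq[OF L], of "i + n" "i + Suc n"] pos(1)[of "i + n"] pos(2)[of i]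
      by (intro mult_left_mono power_mono) auto
    finally show ?case .
  qed simp
  show ?thesis
  proof (cases "j \<ge> k")
    case True
    then obtain n where n: "j = k + n" using le_Suc_ex by blast
    have "ratio_seq L k ^ j * L k = ratio_seq L k ^ k * (ratio_seq L k ^ n * L k)" by (simp add: n power_add)
    also have "\<dots> \<le> ratio_seq L k ^ k * L j" using up[of n] pos(1)[of k] by (simp add: n)
    finally show ?thesis by (simp add: mult.commute)
  next
    case False
    then obtain n where n: "k = j + n" using le_Suc_ex by (metis nat_le_linear)
    have "ratio_seq L k ^ j * L k \<le> ratio_seq L k ^ j * (L j * ratio_seq L k ^ n)"
      using down[of j n] pos(1)[of k] by (simp add: n)
    then show ?thesis by (simp add: n power_add mult_ac)
  qed
qed

text \<open>Superposition of dilates of the kernel. The weights are such that the \<open>j\<close>-th term alone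
  realises the size of the \<open>j\<close>-th derivative, while all terms stay below it.\<close>

lemma exists_extremal:
  fixes L :: "nat \<Rightarrow> real"
  assumes \<alpha>: "\<alpha> > 1" and \<beta>: "\<beta> > \<alpha> - 1" and L: "log_convex_seq L"
  obtains F :: "nat \<Rightarrow> complex \<Rightarrow> complex" and C h c g :: real
  where "C > 0" "h > 0" "c > 0" "g > 0"
    and "\<And>j p. p \<in> sector \<alpha> \<Longrightarrow> (F j has_field_derivative - exp p * F (Suc j) p) (at p)"
    and "\<And>j p. p \<in> sector \<alpha> \<Longrightarrow> norm (F j p) \<le> C * h ^ j * (gevrey_weight \<beta> j * L j)"
    and "\<And>j x. F j (of_real x) \<in> \<real> \<and> Re (F j (of_real x)) \<ge> 0"
    and "\<And>j. \<exists>x. Re (F j (of_real x)) \<ge> c * g ^ j * (gevrey_weight \<beta> j * L j)"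
proof -
  interpret gevrey_kernel \<alpha> \<beta> by unfold_locales (fact \<alpha> \<beta>)+
  define \<mu> where "\<mu> = ratio_seq L"
  \<comment> \<open>Without the 2 the supporting line gives a_k \<mu>_k^j \<le> L_j, with equality
    at k = j. The factor 2^(- k) makes the bounds summable in k and costs only 2^(- j) in the term k
    = j.\<close>
  define a where "a k = L k / (2 * \<mu> k) ^ k" for k
  \<comment> \<open>In the logarithmic coordinate the dilation by \<open>\<mu> k\<close> is the
    translation by its logarithm, which preserves the sector.\<close>
  define u :: "nat \<Rightarrow> nat \<Rightarrow> complex \<Rightarrow> complex"
    where "u j k p = of_real (a k * \<mu> k ^ j) * kernel j (p + of_real (ln (\<mu> k)))" for j k p
  define F where "F j p = (\<Sum>k. u j k p)" for j p
  have \<mu>: "\<mu> k > 0" for k using ratio_seq_pos[OF L] by (simp add: \<mu>_def)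
  have Lpos: "L k > 0" for k by (rule log_convex_pos[OF L])
  have a: "a k > 0" for k using \<mu> Lpos by (simp add: a_def)
  have a_le: "a k * \<mu> k ^ j \<le> L j * (1 / 2) ^ k" for j k
    using log_convex_ratio_power_le[OF L, of k j] \<mu>[of k]
    by (simp add: a_def \<mu>_def power_mult_distrib field_simps)
  have shift: "p + of_real x \<in> sector \<alpha> \<longleftrightarrow> p \<in> sector \<alpha>" for p x
    by (simp add: sector_def)
  have u_le: "norm (u j k p) \<le> L j * (kernel_bound j / c\<^sub>0) * (1 / 2) ^ k" if "p \<in> sector \<alpha>" for j k p
  proof -
    have "norm (u j k p) = a k * \<mu> k ^ j * norm (kernel j (p + of_real (ln (\<mu> k))))"
      using a[of k] \<mu>[of k] by (simp add: u_def norm_mult norm_power)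
    also have "\<dots> \<le> (L j * (1 / 2) ^ k) * (kernel_bound j / c\<^sub>0)"
      using that Lpos[of j] by (intro mult_mono[OF a_le norm_kernel_le]) (auto simp: shift)
    finally show ?thesis by (simp add: mult_ac)
  qed
  have geo: "summable (\<lambda>k. b * (1 / 2) ^ k :: real)" "(\<Sum>k. b * (1 / 2) ^ k) = b * 2" for b :: real
    by (auto intro!: summable_mult summable_geometric simp: suminf_mult suminf_geometric summable_geometric)
  have u_sum: "summable (\<lambda>k. u j k p)" if "p \<in> sector \<alpha>" for j p
    by (rule summable_comparison_test'[OF geo(1) u_le[OF that]])
  have ul: "uniform_limit (sector \<alpha>) (\<lambda>n p. \<Sum>k<n. u j k p) (F j) sequentially" for j
    unfolding F_def by (rule Weierstrass_m_test[OF u_le geo(1)])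
  have u_deriv: "(u j k has_field_derivative - exp p * u (Suc j) k p) (at p)"
    if "p \<in> sector \<alpha>" for j k p
  proof -
    have "((\<lambda>p. kernel j (p + of_real (ln (\<mu> k)))) has_field_derivative
        - exp (p + of_real (ln (\<mu> k))) * kernel (Suc j) (p + of_real (ln (\<mu> k)))) (at p)"
      using that kernel_deriv[of "p + of_real (ln (\<mu> k))"] by (simp add: shift DERIV_shift)
    from DERIV_cmult[OF this, of "of_real (a k * \<mu> k ^ j)"] show ?thesis
      using \<mu>[of k] unfolding u_def
      by (simp add: exp_add exp_of_real mult_ac)
  qed
  have F_deriv: "(F j has_field_derivative - exp p * F (Suc j) p) (at p)" if p: "p \<in> sector \<alpha>" for j p
  proof -
    have "\<exists>g'. \<forall>p\<in>sector \<alpha>. (F j has_field_derivative g' p) (at p) \<and>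
        (\<lambda>n. \<Sum>k<n. - exp p * u (Suc j) k p) \<longlonglongrightarrow> g' p"
    proof (rule has_complex_derivative_uniform_sequence[OF open_sector])
      show "((\<lambda>p. \<Sum>k<n. u j k p) has_field_derivative (\<Sum>k<n. - exp x * u (Suc j) k x)) (at x)"
        if "x \<in> sector \<alpha>" for n x
        by (intro DERIV_sum u_deriv that)
      fix x assume "x \<in> sector \<alpha>"
      then obtain d where d: "d > 0" "cball x d \<subseteq> sector \<alpha>"
        using open_sector open_contains_cball by metis
      then show "\<exists>d. 0 < d \<and> cball x d \<subseteq> sector \<alpha> \<and>
          uniform_limit (cball x d) (\<lambda>n p. \<Sum>k<n. u j k p) (F j) sequentially"
        using uniform_limit_on_subset[OF ul] by blast
    qed
    then obtain g' where g': "(F j has_field_derivative g') (at p)"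
        "(\<lambda>n. \<Sum>k<n. - exp p * u (Suc j) k p) \<longlonglongrightarrow> g'" using p by blast
    have "(\<lambda>k. - exp p * u (Suc j) k p) sums (- exp p * F (Suc j) p)"
      unfolding F_def by (intro sums_mult summable_sums u_sum p)
    then have "g' = - exp p * F (Suc j) p"
      using g'(2) LIMSEQ_unique unfolding sums_def by blast
    then show ?thesis using g'(1) by simp
  qed
  have F_le: "norm (F j p) \<le> L j * (kernel_bound j / c\<^sub>0) * 2" if "p \<in> sector \<alpha>" for j p
  proof -
    have "norm (F j p) \<le> (\<Sum>k. L j * (kernel_bound j / c\<^sub>0) * (1 / 2) ^ k)"
      unfolding F_def by (rule norm_suminf_le[OF u_le[OF that] geo(1)])
    then show ?thesis by (simp only: geo)
  qed
  have u_real: "u j k (of_real x) \<in> \<real>" "Re (u j k (of_real x)) \<ge> 0" for j k x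
  proof -
    have *: "of_real x + of_real (ln (\<mu> k)) = (of_real (x + ln (\<mu> k)) :: complex)" by simp
    show "u j k (of_real x) \<in> \<real>"
      unfolding u_def * by (intro Reals_mult kernel_of_real) auto
    show "Re (u j k (of_real x)) \<ge> 0"
      unfolding u_def * using kernel_of_real(2)[of j "x + ln (\<mu> k)"] a[of k] \<mu>[of k] by simp
  qed
  have Re_sums: "(\<lambda>k. Re (u j k (of_real x))) sums Re (F j (of_real x))" for j x
    unfolding F_def by (intro sums_Re summable_sums u_sum of_real_in_sector)
  have F_real: "F j (of_real x) \<in> \<real>" for j x
  proof -
    have "(\<lambda>k. Im (u j k (of_real x))) sums Im (F j (of_real x))"
      unfolding F_def by (intro sums_Im summable_sums u_sum of_real_in_sector)
    moreover have "Im (u j k (of_real x)) = 0" for k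
      using u_real(1) by (simp add: complex_is_Real_iff)
    ultimately show ?thesis by (simp add: complex_is_Real_iff sums_iff)
  qed
  have F_ge: "Re (F j (of_real x)) \<ge> Re (u j k (of_real x))" for j k x
    using sum_le_suminf[OF sums_summable[OF Re_sums], of "{k}" j x] u_real(2)
    by (simp add: sums_unique[OF Re_sums])
  have lower: "\<exists>x. Re (F j (of_real x)) \<ge> exp (-3) * (exp (-2) / 2) ^ j * (gevrey_weight \<beta> j * L j)" for j
  proof -
    obtain y where y: "Re (kernel j (of_real y)) \<ge> exp (-3) * exp (-2) ^ j * gevrey_weight \<beta> j"
      using kernel_lower_bound by blast
    define x where "x = y - ln (\<mu> j)"
    have x: "of_real x + of_real (ln (\<mu> j)) = (of_real y :: complex)" by (simp add: x_def)
    have "a j * \<mu> j ^ j = L j / 2 ^ j"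
      using \<mu>[of j] by (simp add: a_def power_mult_distrib)
    then have "Re (u j j (of_real x)) = L j / 2 ^ j * Re (kernel j (of_real y))"
      unfolding u_def x by simp
    also have "\<dots> \<ge> L j / 2 ^ j * (exp (-3) * exp (-2) ^ j * gevrey_weight \<beta> j)"
      using y Lpos[of j] by (intro mult_left_mono) auto
    also have "Re (u j j (of_real x)) \<le> Re (F j (of_real x))" by (rule F_ge)
    finally show ?thesis by (intro exI[of _ x]) (simp add: power_divide mult_ac)
  qed
  show thesis
  proof (rule that[of "2 / c\<^sub>0" "(\<beta> / c\<^sub>0) powr \<beta>" "exp (-3)" "exp (-2) / 2" F])
    show "(\<beta> / c\<^sub>0) powr \<beta> > 0" "2 / c\<^sub>0 > 0" using \<beta>_pos c\<^sub>0_pos by auto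
    show "norm (F j p) \<le> 2 / c\<^sub>0 * ((\<beta> / c\<^sub>0) powr \<beta>) ^ j * (gevrey_weight \<beta> j * L j)"
      if "p \<in> sector \<alpha>" for j p
      using F_le[OF that, of j] by (simp add: kernel_bound_def mult_ac)
    show "F j (of_real x) \<in> \<real> \<and> Re (F j (of_real x)) \<ge> 0" for j x
      using F_real u_real(2) F_ge order_trans by blast
  qed (use F_deriv lower in auto)
qed

section \<open>Taylor coefficients and composition\<close>

text \<open>\<open>f\<close> read in the coordinate z = exp p + h. Its derivatives on the surface
  become ordinary derivatives at h = 0, so power series can be used.\<close>

definition zchart :: "(complex \<Rightarrow> complex) \<Rightarrow> complex \<Rightarrow> complex \<Rightarrow> complex" where
  "zchart f p h = f (p + Ln (1 + h / exp p))"

text \<open>For |h| < |exp p| the argument of \<open>Ln\<close> has positive real part and avoids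
  the cut. With q the point reached, exp q = exp p + h, and differentiating the logarithm yields the
  factor 1 / exp q of \<open>zderiv\<close>.\<close>

lemma has_field_derivative_zchart:
  assumes S: "open S" and f: "f holomorphic_on S" and p: "p \<in> S"
  shows "\<forall>\<^sub>F h in nhds 0. (zchart f p has_field_derivative zchart (zderiv f) p h) (at h)"
proof -
  have "isCont (\<lambda>h. p + Ln (1 + h / exp p)) 0"
    by (auto intro!: continuous_intros)
  then have "((\<lambda>h. p + Ln (1 + h / exp p)) \<longlongrightarrow> p) (nhds 0)"
    by (simp add: isCont_def tendsto_nhds_iff)
  then have "\<forall>\<^sub>F h in nhds 0. p + Ln (1 + h / exp p) \<in> S"
    using S p by (rule topological_tendstoD)
  moreover have "\<forall>\<^sub>F h in nhds (0 :: complex). norm h < norm (exp p)"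
    using eventually_nhds_ball[of "norm (exp p)" "0 :: complex"] by (simp add: dist_norm)
  ultimately show ?thesis
  proof eventually_elim
    case (elim h)
    define q where "q = p + Ln (1 + h / exp p)"
    have "norm (h / exp p) < 1" using elim by (simp add: norm_divide)
    then have "Re (1 + h / exp p) > 0"
      using abs_Re_le_cmod[of "h / exp p"] by simp
    then have np: "1 + h / exp p \<notin> \<real>\<^sub>\<le>\<^sub>0" and nz: "1 + h / exp p \<noteq> 0"
      using complex_nonpos_Reals_iff by force+
    have eq: "exp q = exp p * (1 + h / exp p)" unfolding q_def using nz by (simp add: exp_add)
    have fq: "f field_differentiable at q"
      using holomorphic_on_imp_differentiable_at[OF f S] elim by (simp add: q_def)
    have "((\<lambda>h. p + Ln (1 + h / exp p)) has_field_derivative inverse (1 + h / exp p) * (1 / exp p)) (at h)"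
      using np by (auto intro!: derivative_eq_intros simp: field_simps)
    from DERIV_chain2[OF field_differentiable_derivI[OF fq, unfolded q_def] this]
    have "(zchart f p has_field_derivative deriv f q * (inverse (1 + h / exp p) * (1 / exp p))) (at h)"
      unfolding zchart_def q_def .
    also have "deriv f q * (inverse (1 + h / exp p) * (1 / exp p)) = zchart (zderiv f) p h"
      unfolding zchart_def q_def[symmetric] zderiv_eq[OF fq] eq
      by (simp add: divide_inverse mult_ac)
    finally show ?case .
  qed
qed

lemma holomorphic_on_zderiv:
  assumes "open S" "f holomorphic_on S"
  shows "zderiv f holomorphic_on S"
proof (rule holomorphic_transform)
  show "(\<lambda>p. deriv f p / exp p) holomorphic_on S"
    using assms by (intro holomorphic_intros) auto
qed (use assms holomorphic_on_imp_differentiable_at in \<open>auto simp: zderiv_eq\<close>)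

lemma zderiv_funpow_eq_deriv_zchart:
  assumes S: "open S" and "f holomorphic_on S" and p: "p \<in> S"
  shows "(zderiv ^^ n) f p = (deriv ^^ n) (zchart f p) 0"
  using assms(2)
proof (induction n arbitrary: f)
  case 0
  then show ?case by (simp add: zchart_def)
next
  case (Suc n)
  have "(zderiv ^^ Suc n) f p = (deriv ^^ n) (zchart (zderiv f) p) 0"
    unfolding funpow_Suc_right o_def by (intro Suc.IH holomorphic_on_zderiv S Suc.prems)
  also have "\<dots> = (deriv ^^ n) (deriv (zchart f p)) 0"
  proof (rule higher_deriv_cong_ev)
    show "\<forall>\<^sub>F h in nhds 0. zchart (zderiv f) p h = deriv (zchart f p) h"
      using has_field_derivative_zchart[OF S Suc.prems p] by eventually_elim (simp add: DERIV_imp_deriv)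
  qed simp
  finally show ?case by (simp add: funpow_Suc_right del: funpow.simps)
qed

lemma zchart_has_fps_expansion:
  assumes "open S" "f holomorphic_on S" "p \<in> S"
  shows "zchart f p has_fps_expansion Abs_fps (\<lambda>n. (zderiv ^^ n) f p / fact n)"
proof -
  obtain A where A: "open A" "0 \<in> A"
    "\<And>h. h \<in> A \<Longrightarrow> (zchart f p has_field_derivative zchart (zderiv f) p h) (at h)"
    using has_field_derivative_zchart[OF assms] unfolding eventually_nhds by blast
  have "zchart f p holomorphic_on A"
    using A unfolding holomorphic_on_def field_differentiable_def by (meson has_field_derivative_at_within)
  with A have *: "zchart f p has_fps_expansion fps_expansion (zchart f p) 0"
    by blast
  have "fps_expansion (zchart f p) 0 = Abs_fps (\<lambda>n. (zderiv ^^ n) f p / fact n)"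
    by (rule fps_ext) (simp add: fps_expansion_def zderiv_funpow_eq_deriv_zchart[OF assms])
  with * show ?thesis by simp
qed

text \<open>Induction on \<open>l\<close>, peeling off one factor F of order i. The number
  \<open>q\<close> collects the weights already split off, so the hypothesis on complete
  compositions passes to the rest. Taking 2 H in place of H leaves a factor 2^(- i) whose sum is at
  most 1; thus compositions need not be counted.\<close>

lemma fps_power_nth_bound:
  fixes F :: "complex fps" and m :: "nat \<Rightarrow> real"
  assumes F0: "fps_nth F 0 = 0" and F: "\<And>j. j \<ge> 1 \<Longrightarrow> norm (fps_nth F j) \<le> C * H ^ j * m j"
    and nonneg: "C \<ge> 0" "H \<ge> 0" "\<And>j. m j \<ge> 0" and "B \<ge> 0" "q \<ge> 0"
    and "\<And>js. \<lbrakk>length js = l; \<forall>j\<in>set js. 1 \<le> j; sum_list js = n\<rbrakk> \<Longrightarrow> q * prod_list (map m js) \<le> B"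
  shows "q * norm (fps_nth (F ^ l) n) \<le> C ^ l * (2 * H) ^ n * B"
  using assms(6-)
proof (induction l arbitrary: n q)
  case 0
  show ?case using 0(1) 0(3)[of "[]"] nonneg by (cases n) auto
next
  case (Suc l)
  have step: "q * norm (fps_nth F i * fps_nth (F ^ l) (n - i)) \<le> C ^ Suc l * (2 * H) ^ n * B * (1 / 2) ^ i"
    if i: "i \<in> {1..n}" for i
  proof -
    have IH: "(q * m i) * norm (fps_nth (F ^ l) (n - i)) \<le> C ^ l * (2 * H) ^ (n - i) * B"
    proof (rule Suc.IH)
      show "q * m i \<ge> 0" using Suc.prems nonneg by simp
      show "q * m i * prod_list (map m js) \<le> B"
        if "length js = l" "\<forall>j\<in>set js. 1 \<le> j" "sum_list js = n - i" for js
        using Suc.prems(3)[of "i # js"] that i by (simp add: mult.assoc)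
    qed fact
    have "q * norm (fps_nth F i * fps_nth (F ^ l) (n - i)) \<le>
        q * (C * H ^ i * m i * norm (fps_nth (F ^ l) (n - i)))"
      unfolding norm_mult using F[of i] i Suc.prems by (intro mult_left_mono mult_right_mono) auto
    also have "\<dots> = C * H ^ i * ((q * m i) * norm (fps_nth (F ^ l) (n - i)))" by (simp add: mult_ac)
    also have "\<dots> \<le> C * H ^ i * (C ^ l * (2 * H) ^ (n - i) * B)"
      using IH nonneg by (intro mult_left_mono) auto
    also have "\<dots> = C ^ Suc l * (H ^ i * (2 * H) ^ (n - i)) * B" by (simp add: mult_ac)
    also have "H ^ i * (2 * H) ^ (n - i) = (2 * H) ^ n * (1 / 2) ^ i"
      using i by (simp add: power_mult_distrib power_divide field_simps flip: power_add)
    finally show ?thesis by (simp add: mult_ac)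
  qed
  have "fps_nth (F ^ Suc l) n = (\<Sum>i=0..n. fps_nth F i * fps_nth (F ^ l) (n - i))"
    by (simp add: fps_mult_nth)
  also have "\<dots> = (\<Sum>i=1..n. fps_nth F i * fps_nth (F ^ l) (n - i))"
    by (rule sum.mono_neutral_right) (auto simp: F0 not_le)
  finally have "q * norm (fps_nth (F ^ Suc l) n) \<le> q * (\<Sum>i=1..n. norm (fps_nth F i * fps_nth (F ^ l) (n - i)))"
    using Suc.prems by (simp add: norm_sum mult_left_mono)
  also have "\<dots> \<le> (\<Sum>i=1..n. C ^ Suc l * (2 * H) ^ n * B * (1 / 2) ^ i)"
    unfolding sum_distrib_left by (intro sum_mono step)
  also have "\<dots> = C ^ Suc l * (2 * H) ^ n * B * (\<Sum>i=1..n. (1 / 2) ^ i)"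
    by (simp add: sum_distrib_left)
  also have "\<dots> \<le> C ^ Suc l * (2 * H) ^ n * B * 1"
  proof (rule mult_left_mono)
    have "(\<Sum>i=1..n. (1 / 2) ^ i :: real) = 1 - (1 / 2) ^ n"
      by (induction n) auto
    then show "(\<Sum>i=1..n. (1 / 2) ^ i :: real) \<le> 1" by simp
  qed (use nonneg Suc.prems in auto)
  finally show ?case by simp
qed

text \<open>Only l \<le> n contribute, so (K C)^l is at most \<open>max 1 (K * C)\<close> to the
  power n. The number n + 1 of terms is at most 2^n, which together with the 2 H for powers gives
  the 4.\<close>

lemma fps_compose_nth_bound:
  fixes F G :: "complex fps" and m g :: "nat \<Rightarrow> real"
  assumes F0: "fps_nth F 0 = 0" and F: "\<And>j. j \<ge> 1 \<Longrightarrow> norm (fps_nth F j) \<le> C * H ^ j * m j"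
    and G: "\<And>l. norm (fps_nth G l) \<le> A * K ^ l * g l"
    and nonneg: "C \<ge> 0" "H \<ge> 0" "\<And>j. m j \<ge> 0" "A \<ge> 0" "K \<ge> 0" "\<And>l. g l \<ge> 0" "B \<ge> 0"
    and B: "\<And>js. \<lbrakk>\<forall>j\<in>set js. 1 \<le> j; sum_list js = n\<rbrakk> \<Longrightarrow> g (length js) * prod_list (map m js) \<le> B"
  shows "norm (fps_nth (fps_compose G F) n) \<le> A * (4 * max 1 (K * C) * H) ^ n * B"
proof -
  let ?Q = "max 1 (K * C)"
  have term_le: "norm (fps_nth G l * fps_nth (F ^ l) n) \<le> A * ?Q ^ n * (2 * H) ^ n * B" if "l \<in> {0..n}" for l
  proof -
    have "norm (fps_nth G l * fps_nth (F ^ l) n) \<le> A * K ^ l * (g l * norm (fps_nth (F ^ l) n))"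
      using mult_right_mono[OF G[of l] norm_ge_zero[of "fps_nth (F ^ l) n"]] by (simp add: norm_mult mult_ac)
    also have "\<dots> \<le> A * K ^ l * (C ^ l * (2 * H) ^ n * B)"
      using B nonneg by (intro mult_left_mono fps_power_nth_bound[OF F0 F]) auto
    also have "\<dots> = A * (K * C) ^ l * (2 * H) ^ n * B" by (simp add: power_mult_distrib mult_ac)
    also have "\<dots> \<le> A * ?Q ^ n * (2 * H) ^ n * B"
    proof -
      have "(K * C) ^ l \<le> ?Q ^ l" using nonneg by (intro power_mono) auto
      also have "\<dots> \<le> ?Q ^ n" using that by (intro power_increasing) auto
      finally show ?thesis using nonneg by (intro mult_right_mono mult_left_mono) auto
    qed
    finally show ?thesis .
  qed
  have "norm (fps_nth (fps_compose G F) n) \<le> (\<Sum>l=0..n. norm (fps_nth G l * fps_nth (F ^ l) n))"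
    by (simp add: fps_compose_nth norm_sum)
  also have "\<dots> \<le> (\<Sum>l=0..n. A * ?Q ^ n * (2 * H) ^ n * B)"
    by (intro sum_mono term_le)
  also have "\<dots> = real (Suc n) * (A * ?Q ^ n * (2 * H) ^ n * B)" by simp
  also have "\<dots> \<le> 2 ^ n * (A * ?Q ^ n * (2 * H) ^ n * B)"
    using of_nat_mono[OF Suc_leI[OF less_exp[of n]], where 'a = real] nonneg
    by (intro mult_right_mono) auto
  also have "\<dots> = A * (4 * ?Q * H) ^ n * B"
  proof -
    have "(2::real) ^ n * 2 ^ n = 4 ^ n" by (simp flip: power_mult_distrib)
    then show ?thesis by (simp add: power_mult_distrib mult_ac)
  qed
  finally show ?thesis .
qed

section \<open>Membership in the classes and the composition estimate\<close>

lemma class_AD: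
  assumes "f \<in> class_A M S" "positive_seq M"
  obtains C h where "C > 0" "h > 0" "\<And>p j. p \<in> S \<Longrightarrow> norm ((zderiv ^^ j) f p) \<le> C * h ^ j * M j"
proof -
  obtain h C where h: "h > 0" and C: "\<And>p j. p \<in> S \<Longrightarrow> norm ((zderiv ^^ j) f p) / (h ^ j * M j) \<le> C"
    using assms unfolding class_A_def by blast
  have pos: "h ^ j * M j > 0" for j using h assms by (simp add: positive_seq_def)
  have "norm ((zderiv ^^ j) f p) \<le> max 1 C * h ^ j * M j" if "p \<in> S" for p j
  proof -
    have "norm ((zderiv ^^ j) f p) / (h ^ j * M j) \<le> max 1 C" using C[OF that, of j] by simp
    then show ?thesis using pos[of j] by (simp add: pos_divide_le_eq mult.assoc)
  qed
  then show thesis using h by (intro that[of "max 1 C" h]) auto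
qed

lemma class_AI:
  assumes "f holomorphic_on S" "positive_seq M" "h > 0"
    and "\<And>p j. p \<in> S \<Longrightarrow> norm ((zderiv ^^ j) f p) \<le> C * h ^ j * M j"
  shows "f \<in> class_A M S"
proof -
  have "norm ((zderiv ^^ j) f p) / (h ^ j * M j) \<le> C" if "p \<in> S" for p j
  proof -
    have "h ^ j * M j > 0" using assms by (simp add: positive_seq_def)
    then show ?thesis using assms(4)[OF that, of j] by (simp add: pos_divide_le_eq mult.assoc)
  qed
  then show ?thesis unfolding class_A_def using assms(1,3) by blast
qed

text \<open>\<open>gs\<close> is the weight of the outer function, constant or
  \<open>check_seq M\<close>. Faa di Bruno's formula enters as the composition of the series of g at
  f p with that of f at p freed from its constant term. The empty list in the last hypothesis serves
  order 0.\<close>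

lemma compose_in_class_A:
  assumes S: "open S" and M: "positive_seq M" and f: "f \<in> class_A M S"
    and U: "open U" "f ` S \<subseteq> U" and g: "g holomorphic_on U"
    and gb: "\<And>w l. w \<in> f ` S \<Longrightarrow> norm ((deriv ^^ l) g w) \<le> A * K ^ l * gs l * fact l"
    and nonneg: "A \<ge> 0" "K \<ge> 0" "\<And>l. gs l \<ge> 0"
    and h: "h > 0" and B: "B \<ge> 0"
    and comp: "\<And>js. \<forall>j\<in>set js. 1 \<le> j \<Longrightarrow>
      gs (length js) * prod_list (map (check_seq M) js) \<le> B * h ^ sum_list js * check_seq M (sum_list js)"
  shows "g \<circ> f \<in> class_A M S"
proof -
  obtain C H where C: "C > 0" "H > 0" and fb: "\<And>p j. p \<in> S \<Longrightarrow> norm ((zderiv ^^ j) f p) \<le> C * H ^ j * M j"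
    using class_AD[OF f M] by blast
  have holf: "f holomorphic_on S" using f by (simp add: class_A_def)
  have holgf: "g \<circ> f holomorphic_on S"
    by (rule holomorphic_on_compose_gen[OF holf g U(2)])
  have m: "check_seq M j \<ge> 0" for j
    using M by (simp add: check_seq_def positive_seq_def order.strict_implies_order)
  define H' where "H' = 4 * max 1 (K * C) * H * h"
  have "norm ((zderiv ^^ n) (g \<circ> f) p) \<le> A * B * H' ^ n * M n" if p: "p \<in> S" for p n
  proof -
    define F where "F = Abs_fps (\<lambda>n. (zderiv ^^ n) f p / fact n)"
    have F: "(\<lambda>h. zchart f p h - f p) has_fps_expansion (F - fps_const (f p))"
      unfolding F_def by (intro fps_expansion_intros zchart_has_fps_expansion[OF S holf p])
    have F0: "fps_nth (F - fps_const (f p)) 0 = 0" by (simp add: F_def)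
    have "g analytic_on {f p}"
      using g U p by (auto simp: analytic_at)
    then have G: "(\<lambda>w. g (f p + w)) has_fps_expansion fps_expansion g (f p)"
      by (rule analytic_at_imp_has_fps_expansion)
    have "((\<lambda>w. g (f p + w)) \<circ> (\<lambda>h. zchart f p h - f p)) has_fps_expansion
        fps_compose (fps_expansion g (f p)) (F - fps_const (f p))"
      by (rule has_fps_expansion_compose[OF G F F0])
    also have "((\<lambda>w. g (f p + w)) \<circ> (\<lambda>h. zchart f p h - f p)) = zchart (g \<circ> f) p"
      by (auto simp: zchart_def)
    finally have "fps_nth (fps_compose (fps_expansion g (f p)) (F - fps_const (f p))) n =
        (zderiv ^^ n) (g \<circ> f) p / fact n"
      by (simp add: fps_nth_fps_expansion zderiv_funpow_eq_deriv_zchart[OF S holgf p])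
    moreover have "norm (fps_nth (fps_compose (fps_expansion g (f p)) (F - fps_const (f p))) n)
        \<le> A * (4 * max 1 (K * C) * H) ^ n * (B * h ^ n * check_seq M n)"
    proof (rule fps_compose_nth_bound[OF F0])
      show "norm (fps_nth (F - fps_const (f p)) j) \<le> C * H ^ j * check_seq M j" if "j \<ge> 1" for j
        using fb[OF p, of j] that by (simp add: F_def norm_divide check_seq_def divide_right_mono)
      show "norm (fps_nth (fps_expansion g (f p)) l) \<le> A * K ^ l * gs l" for l
        using gb[of "f p" l] p by (simp add: fps_expansion_def norm_divide pos_divide_le_eq)
      show "gs (length js) * prod_list (map (check_seq M) js) \<le> B * h ^ n * check_seq M n"
        if "\<forall>j\<in>set js. 1 \<le> j" "sum_list js = n" for js
        using comp[OF that(1)] that(2) by simp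
    qed (use C nonneg B h m in auto)
    ultimately have "norm ((zderiv ^^ n) (g \<circ> f) p) / fact n \<le>
        A * (4 * max 1 (K * C) * H) ^ n * (B * h ^ n * (M n / fact n))"
      by (simp add: norm_divide check_seq_def)
    then show ?thesis by (simp add: H'_def power_mult_distrib field_simps)
  qed
  moreover have "H' > 0" using C h by (simp add: H'_def)
  ultimately show ?thesis by (intro class_AI[OF holgf M]) auto
qed

text \<open>Cauchy's inequality on discs of one common radius around the points of \<open>Z\<close>;
  all of them lie in a compact subset of \<open>U\<close>, where g is bounded.\<close>

lemma deriv_bound_on_compact:
  fixes g :: "complex \<Rightarrow> complex"
  assumes U: "open U" and g: "g holomorphic_on U" and Z: "compact Z" "Z \<subseteq> U"
  obtains A K where "A > 0" "K > 0" "\<And>w l. w \<in> Z \<Longrightarrow> norm ((deriv ^^ l) g w) \<le> A * K ^ l * fact l"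
proof -
  obtain e where e: "e > 0" "(\<Union>x\<in>Z. cball x e) \<subseteq> U"
    using compact_subset_open_imp_cball_epsilon_subset[OF Z(1) U Z(2)] .
  define Z' where "Z' = {x + y | x y. x \<in> Z \<and> y \<in> cball 0 e}"
  have "Z' \<subseteq> U"
    using e by (force simp: Z'_def dist_norm)
  have ball: "v \<in> Z'" if "w \<in> Z" "dist w v \<le> e" for v w
  proof -
    have "v = w + (v - w)" "v - w \<in> cball 0 e"
      using that by (auto simp: dist_norm norm_minus_commute)
    then show ?thesis unfolding Z'_def using that by blast
  qed
  have "compact Z'" unfolding Z'_def by (intro compact_sums Z compact_cball)
  then have "bounded (g ` Z')"
    using g \<open>Z' \<subseteq> U\<close> holomorphic_on_imp_continuous_on holomorphic_on_subset
    by (intro compact_imp_bounded compact_continuous_image) blast+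
  then obtain A where A: "A > 0" "\<And>x. x \<in> Z' \<Longrightarrow> norm (g x) \<le> A"
    unfolding bounded_pos by blast
  have "norm ((deriv ^^ l) g w) \<le> A * (1 / e) ^ l * fact l" if "w \<in> Z" for w l
  proof -
    have sub: "cball w e \<subseteq> U" using e that by auto
    then have "g holomorphic_on cball w e" using g holomorphic_on_subset by blast
    then have "norm ((deriv ^^ l) g w) \<le> fact l * A / e ^ l"
      using e A(2)[OF ball[OF that]]
      by (intro Cauchy_inequality holomorphic_on_imp_continuous_on)
        (auto intro: holomorphic_on_subset simp: dist_norm)
    then show ?thesis by (simp add: power_divide mult_ac)
  qed
  then show thesis using that[of A "1 / e"] A e by auto
qed

section \<open>Weight conditions and closedness\<close>

lemma check_seq_pos: "positive_seq M \<Longrightarrow> check_seq M j > 0"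
  by (simp add: check_seq_def positive_seq_def)

lemma powr_inverse_power: "x > 0 \<Longrightarrow> n \<ge> 1 \<Longrightarrow> (x powr (1 / real n)) ^ n = x"
  by (simp add: powr_powr flip: powr_realpow)

text \<open>\<open>R\<close> is a factor attached to every entry: it is 1 for holomorphic outer
  functions, while under (dc) it restores the order that each entry loses.\<close>

lemma prod_list_le_power:
  fixes m :: "nat \<Rightarrow> real"
  assumes "R \<ge> 0" "Q \<ge> 0" "\<And>j. m j \<ge> 0" "\<forall>j\<in>set js. m j * R \<le> Q ^ j"
  shows "prod_list (map m js) * R ^ length js \<le> Q ^ sum_list js"
  using assms(4)
proof (induction js)
  case (Cons j js)
  have "prod_list (map m (j # js)) * R ^ length (j # js) = (m j * R) * (prod_list (map m js) * R ^ length js)"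
    by (simp add: mult_ac)
  also have "\<dots> \<le> Q ^ j * Q ^ sum_list js"
    using Cons assms by (intro mult_mono mult_nonneg_nonneg prod_list_nonneg) auto
  finally show ?case by (simp add: power_add)
qed simp

lemma length_le_sum_list: "\<forall>j\<in>set js. 1 \<le> j \<Longrightarrow> length js \<le> sum_list (js :: nat list)"
  by (induction js) auto

section \<open>The weight conditions as bounds for products over compositions\<close>

lemma raiE:
  assumes "rai M" and M: "positive_seq M"
  obtains C where "C \<ge> 1"
    "\<And>j n. 1 \<le> j \<Longrightarrow> j \<le> n \<Longrightarrow> check_seq M j \<le> (C * check_seq M n powr (1 / real n)) ^ j"
proof -
  obtain C where C: "C > 0" "\<And>j n. 1 \<le> j \<Longrightarrow> j \<le> n \<Longrightarrow>
      check_seq M j powr (1 / real j) \<le> C * check_seq M n powr (1 / real n)"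
    using assms unfolding rai_def by blast
  show thesis
  proof (rule that[of "max 1 C"])
    fix j n :: nat assume jn: "1 \<le> j" "j \<le> n"
    have "check_seq M j powr (1 / real j) \<le> max 1 C * check_seq M n powr (1 / real n)"
      by (rule order_trans[OF C(2)[OF jn]]) (intro mult_right_mono, auto)
    from power_mono[OF this, of j] show "check_seq M j \<le> (max 1 C * check_seq M n powr (1 / real n)) ^ j"
      using powr_inverse_power[OF check_seq_pos[OF M] jn(1)] by simp
  qed simp
qed

text \<open>Inverse-closedness yields inequalities between integer powers; both sides of (rai) are
  therefore raised to the power j k.\<close>

lemma raiI:
  assumes M: "positive_seq M" and C: "C > 0"
    and le: "\<And>j k. 1 \<le> j \<Longrightarrow> j \<le> k \<Longrightarrow> check_seq M j ^ k \<le> C ^ (j * k) * check_seq M k ^ j"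
  shows "rai M"
  unfolding rai_def
proof (intro exI[of _ C] conjI allI impI C)
  fix j k :: nat assume jk: "1 \<le> j \<and> j \<le> k"
  have 1: "(check_seq M j powr (1 / real j)) ^ (j * k) = check_seq M j ^ k"
    using powr_inverse_power[OF check_seq_pos[OF M], of j] jk by (simp add: power_mult)
  have 2: "(check_seq M k powr (1 / real k)) ^ (j * k) = check_seq M k ^ j"
    using powr_inverse_power[OF check_seq_pos[OF M], of k] jk by (simp add: power_mult mult.commute[of j k])
  have "(check_seq M j powr (1 / real j)) ^ (j * k) \<le> (C * check_seq M k powr (1 / real k)) ^ (j * k)"
    unfolding power_mult_distrib 1 2 using le jk by simp
  then show "check_seq M j powr (1 / real j) \<le> C * check_seq M k powr (1 / real k)"
    using C jk by (subst (asm) power_mono_iff) auto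
qed

text \<open>With R = C m_n^(1/n), where n is the sum of the list, every factor satisfies m_i \<le>
  R^i. The exponents add up to n, and R^n = C^n m_n.\<close>

lemma rai_prod_bound:
  assumes "rai M" and M: "positive_seq M" and M0: "M 0 = 1"
  obtains C where "C \<ge> 1" "\<And>js. \<forall>j\<in>set js. 1 \<le> j \<Longrightarrow>
    prod_list (map (check_seq M) js) \<le> C ^ sum_list js * check_seq M (sum_list js)"
proof -
  obtain C where C: "C \<ge> 1"
    "\<And>j n. 1 \<le> j \<Longrightarrow> j \<le> n \<Longrightarrow> check_seq M j \<le> (C * check_seq M n powr (1 / real n)) ^ j"
    using raiE[OF assms(1,2)] by blast
  show thesis
  proof (rule that[OF C(1)])
    fix js :: "nat list" assume js: "\<forall>j\<in>set js. 1 \<le> j"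
    define n where "n = sum_list js"
    show "prod_list (map (check_seq M) js) \<le> C ^ sum_list js * check_seq M (sum_list js)"
    proof (cases "js = []")
      case True
      then show ?thesis by (simp add: check_seq_def M0)
    next
      case False
      then have n: "n \<ge> 1" using length_le_sum_list[OF js] by (cases js) (auto simp: n_def)
      have "prod_list (map (check_seq M) js) * 1 ^ length js \<le> (C * check_seq M n powr (1 / real n)) ^ sum_list js"
        using C js member_le_sum_list[of _ js] check_seq_pos[OF M]
        by (intro prod_list_le_power) (auto simp: n_def order.strict_implies_order)
      also have "\<dots> = C ^ n * check_seq M n"
        using powr_inverse_power[OF check_seq_pos[OF M] n] by (simp add: power_mult_distrib n_def)
      finally show ?thesis by (simp add: n_def)
    qed
  qed
qed

text \<open>By (dc) a factor \<open>m\<^sub>j\<close> may be replaced by \<open>m\<^sub>j\<^sub>-\<^sub>1\<close>; the total order lost,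
  \<open>length js\<close>, is exactly that of the outer factor.\<close>

lemma rai_dc_prod_bound:
  assumes "rai M" and M: "positive_seq M" and M0: "M 0 = 1" and dc: "dc M"
  obtains C where "C \<ge> 1" "\<And>js. \<forall>j\<in>set js. 1 \<le> j \<Longrightarrow>
    check_seq M (length js) * prod_list (map (check_seq M) js) \<le> C ^ sum_list js * check_seq M (sum_list js)"
proof -
  note pos = check_seq_pos[OF M]
  obtain C where C: "C \<ge> 1"
    "\<And>j n. 1 \<le> j \<Longrightarrow> j \<le> n \<Longrightarrow> check_seq M j \<le> (C * check_seq M n powr (1 / real n)) ^ j"
    using raiE[OF assms(1,2)] by blast
  obtain D where D: "D \<ge> 1" "\<And>j. M (j + 1) \<le> D ^ (j + 1) * M j"
    using dc unfolding dc_def by blast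
  have D': "check_seq M (Suc j) \<le> D ^ Suc j * check_seq M j" for j
  proof -
    have "check_seq M (Suc j) \<le> D ^ Suc j * M j / fact (Suc j)"
      unfolding check_seq_def using D(2)[of j] by (intro divide_right_mono) auto
    also have "\<dots> \<le> D ^ Suc j * M j / fact j"
      using D M by (intro divide_left_mono fact_mono mult_nonneg_nonneg)
        (auto simp: positive_seq_def order.strict_implies_order)
    finally show ?thesis by (simp add: check_seq_def)
  qed
  show thesis
  proof (rule that[of "D * C"])
    show "1 \<le> D * C" using C D mult_mono[of 1 D 1 C] by simp
    fix js :: "nat list" assume js: "\<forall>j\<in>set js. 1 \<le> j"
    define n where "n = sum_list js"
    define R where "R = C * check_seq M n powr (1 / real n)"
    have R: "R > 0" using C pos[of n] by (simp add: R_def)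
    show "check_seq M (length js) * prod_list (map (check_seq M) js)
      \<le> (D * C) ^ sum_list js * check_seq M (sum_list js)"
    proof (cases "js = []")
      case True
      then show ?thesis by (simp add: check_seq_def M0)
    next
      case False
      then have l: "length js \<ge> 1" "length js \<le> n" "n \<ge> 1"
        using length_le_sum_list[OF js] by (simp_all add: n_def Suc_le_eq order.strict_trans2[of 0 "length js"])
      have "check_seq M j * R \<le> (D * R) ^ j" if j: "j \<in> set js" for j
      proof -
        obtain i where i: "j = Suc i" using js j by (cases j) auto
        have jn: "j \<le> n" using member_le_sum_list[OF j] by (simp add: n_def)
        \<comment> \<open>An entry 1 leads to the index \<open>i = 0\<close>, about which (rai) says
          nothing; there \<open>M 0 = 1\<close> is used.\<close>
        have "check_seq M i \<le> R ^ i"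
          using C(2)[of i n] jn i by (cases "i = 0") (auto simp: R_def check_seq_def M0)
        then have "check_seq M j * R \<le> D ^ j * R ^ i * R"
          using D'[of i] D R unfolding i
          by (intro mult_right_mono) (auto intro: order_trans mult_left_mono)
        then show ?thesis by (simp add: i power_mult_distrib mult_ac)
      qed
      then have *: "prod_list (map (check_seq M) js) * R ^ length js \<le> (D * R) ^ n"
        unfolding n_def using R D pos by (intro prod_list_le_power) (auto simp: order.strict_implies_order)
      have "check_seq M (length js) * prod_list (map (check_seq M) js) \<le>
          R ^ length js * prod_list (map (check_seq M) js)"
        unfolding R_def using C(2)[OF l(1,2)] pos
        by (intro mult_right_mono prod_list_nonneg) (auto simp: order.strict_implies_order)
      also have "\<dots> \<le> (D * R) ^ n" using * by (simp add: mult.commute)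
      also have "\<dots> = (D * C) ^ n * check_seq M n"
        unfolding R_def using powr_inverse_power[OF pos l(3)] by (simp add: power_mult_distrib)
      finally show ?thesis by (simp add: n_def)
    qed
  qed
qed

lemma rai_dc_imp_FdB:
  assumes "rai M" "positive_seq M" and M0: "M 0 = 1" and "dc M"
  shows "FdB M"
proof -
  obtain C where C: "C \<ge> 1" "\<And>js. \<forall>j\<in>set js. 1 \<le> j \<Longrightarrow>
    check_seq M (length js) * prod_list (map (check_seq M) js) \<le> C ^ sum_list js * check_seq M (sum_list js)"
    using rai_dc_prod_bound[OF assms] by blast
  have "circ_seq (check_seq M) k \<le> 1 * C ^ k * check_seq M k" for k
  proof (cases "k = 0")
    case True
    then show ?thesis by (simp add: circ_seq_def check_seq_def M0)
  next
    case False
    let ?A = "{check_seq M (length js) * prod_list (map (check_seq M) js) |js. js \<in> compositions k}"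
    have "finite ?A" using finite_compositions by simp
    moreover have "?A \<noteq> {}" using compositions_nonempty[of k] False by auto
    moreover have "x \<le> C ^ k * check_seq M k" if "x \<in> ?A" for x
      using that C(2) unfolding compositions_def by blast
    ultimately have "Max ?A \<le> C ^ k * check_seq M k" by (intro Max.boundedI)
    then show ?thesis using False by (simp add: circ_seq_def)
  qed
  then show ?thesis unfolding FdB_def using C(1) by blast
qed

lemma FdB_prod_bound:
  assumes "FdB M" and M0: "M 0 = 1"
  obtains C h where "C \<ge> 1" "h \<ge> 1" "\<And>js. \<forall>j\<in>set js. 1 \<le> j \<Longrightarrow>
    check_seq M (length js) * prod_list (map (check_seq M) js) \<le> C * h ^ sum_list js * check_seq M (sum_list js)"
proof -
  obtain C h where C: "C \<ge> 1" "h \<ge> 1" "\<And>k. circ_seq (check_seq M) k \<le> C * h ^ k * check_seq M k"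
    using assms unfolding FdB_def by blast
  show thesis
  proof (rule that[OF C(1,2)])
    fix js :: "nat list" assume js: "\<forall>j\<in>set js. 1 \<le> j"
    define k where "k = sum_list js"
    show "check_seq M (length js) * prod_list (map (check_seq M) js) \<le>
      C * h ^ sum_list js * check_seq M (sum_list js)"
    proof (cases "js = []")
      case True
      then show ?thesis using C by (simp add: check_seq_def M0)
    next
      case False
      then have "length js > 0" by simp
      then have k: "k \<noteq> 0" using length_le_sum_list[OF js] unfolding k_def by linarith
      let ?A = "{check_seq M (length js) * prod_list (map (check_seq M) js) |js. js \<in> compositions k}"
      have "finite ?A" using finite_compositions by simp
      moreover have "js \<in> compositions k" using js False by (simp add: compositions_def k_def)
      ultimately have "check_seq M (length js) * prod_list (map (check_seq M) js) \<le> Max ?A"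
        by (intro Max_ge) auto
      also have "\<dots> \<le> C * h ^ k * check_seq M k" using C(3)[of k] k by (simp add: circ_seq_def)
      finally show ?thesis by (simp add: k_def)
    qed
  qed
qed

section \<open>From weight conditions to closedness, and between closedness properties\<close>

lemma compact_closure_image:
  assumes f: "f \<in> class_A M S" and M: "positive_seq M"
  shows "compact (closure (f ` S))"
proof -
  obtain C h where "C > 0" "h > 0" and b: "\<And>p j. p \<in> S \<Longrightarrow> norm ((zderiv ^^ j) f p) \<le> C * h ^ j * M j"
    using class_AD[OF f M] by blast
  have "bounded (f ` S)"
    using b[of _ 0] by (auto simp: bounded_iff)
  then show ?thesis by (simp add: compact_closure)
qed

lemma rai_imp_holomorphically_closed:
  assumes "rai M" and M: "positive_seq M" and M0: "M 0 = 1" and S: "open S"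
  shows "holomorphically_closed M S"
  unfolding holomorphically_closed_def
proof (intro ballI allI impI)
  fix f U g assume f: "f \<in> class_A M S" and U: "open U \<and> closure (f ` S) \<subseteq> U" and g: "g holomorphic_on U"
  obtain C where C: "C \<ge> 1" "\<And>js. \<forall>j\<in>set js. 1 \<le> j \<Longrightarrow>
    prod_list (map (check_seq M) js) \<le> C ^ sum_list js * check_seq M (sum_list js)"
    using rai_prod_bound[OF assms(1-3)] by blast
  obtain A K where A: "A > 0" "K > 0"
    "\<And>w l. w \<in> closure (f ` S) \<Longrightarrow> norm ((deriv ^^ l) g w) \<le> A * K ^ l * fact l"
    using deriv_bound_on_compact[OF conjunct1[OF U] g compact_closure_image[OF f M] conjunct2[OF U]] by blast
  note sub = closure_subset[of "f ` S"]
  show "g \<circ> f \<in> class_A M S"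
  proof (rule compose_in_class_A[OF S M f conjunct1[OF U] order_trans[OF sub conjunct2[OF U]] g])
    show "norm ((deriv ^^ l) g w) \<le> A * K ^ l * 1 * fact l" if "w \<in> f ` S" for w l
      using A(3)[OF subsetD[OF sub that]] by simp
    show "1 * prod_list (map (check_seq M) js) \<le> 1 * C ^ sum_list js * check_seq M (sum_list js)"
      if "\<forall>j\<in>set js. 1 \<le> j" for js
      using C(2)[OF that] by simp
  qed (use A C in simp_all)
qed

lemma FdB_imp_composition_closed:
  assumes "FdB M" and M: "positive_seq M" and M0: "M 0 = 1" and S: "open S"
  shows "composition_closed M S"
  unfolding composition_closed_def
proof (intro ballI allI impI)
  fix f U g assume f: "f \<in> class_A M S" and U: "open U \<and> closure (f ` S) \<subseteq> U" and g: "g \<in> class_H M U"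
  obtain C h where C: "C \<ge> 1" "h \<ge> 1" "\<And>js. \<forall>j\<in>set js. 1 \<le> j \<Longrightarrow>
    check_seq M (length js) * prod_list (map (check_seq M) js) \<le> C * h ^ sum_list js * check_seq M (sum_list js)"
    using FdB_prod_bound[OF assms(1,3)] by blast
  have "\<forall>Z. compact Z \<and> Z \<subseteq> U \<longrightarrow>
      (\<exists>h>0. \<exists>C. \<forall>z\<in>Z. \<forall>j. cmod ((deriv ^^ j) g z) / (h ^ j * M j) \<le> C)"
    using g by (simp add: class_H_def)
  from this[rule_format, OF conjI, OF compact_closure_image[OF f M] conjunct2[OF U]]
  obtain k A where k: "k > 0"
    and A: "\<And>w l. w \<in> closure (f ` S) \<Longrightarrow> norm ((deriv ^^ l) g w) / (k ^ l * M l) \<le> A"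
    by blast
  note sub = closure_subset[of "f ` S"]
  have gb: "norm ((deriv ^^ l) g w) \<le> max 0 A * k ^ l * check_seq M l * fact l" if "w \<in> f ` S" for w l
  proof -
    have "norm ((deriv ^^ l) g w) / (k ^ l * M l) \<le> max 0 A" using A[OF subsetD[OF sub that], of l] by linarith
    moreover have "k ^ l * M l > 0" using k M by (simp add: positive_seq_def)
    ultimately have "norm ((deriv ^^ l) g w) \<le> max 0 A * (k ^ l * M l)"
      by (simp only: pos_divide_le_eq)
    then show ?thesis by (simp add: check_seq_def mult.assoc)
  qed
  have g': "g holomorphic_on U" using g by (simp add: class_H_def)
  show "g \<circ> f \<in> class_A M S"
    by (rule compose_in_class_A[OF S M f conjunct1[OF U] order_trans[OF sub conjunct2[OF U]] g' gb _ _ _ _ _ C(3)])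
      (use k C in \<open>simp_all add: order.strict_implies_order[OF check_seq_pos[OF M]]\<close>)
qed

lemma liminf_root_pos:
  assumes "liminf (\<lambda>j. ereal ((M j / fact j) powr (1 / real j))) > 0" and M: "positive_seq M"
  obtains A K where "A > 0" "K > 0" "\<And>j. 1 \<le> A * K ^ j * check_seq M j"
proof -
  note pos = check_seq_pos[OF M]
  obtain c where c: "0 < ereal c" "ereal c < liminf (\<lambda>j. ereal ((M j / fact j) powr (1 / real j)))"
    using ereal_dense2[OF assms(1)] by blast
  have "\<forall>\<^sub>F j in sequentially. ereal c < ereal ((M j / fact j) powr (1 / real j))"
    using less_LiminfD[OF c(2)] .
  then obtain N where N: "\<And>j. j \<ge> N \<Longrightarrow> c < check_seq M j powr (1 / real j)"
    unfolding eventually_sequentially check_seq_def by auto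
  have c0: "c > 0" using c by simp
  \<comment> \<open>The liminf controls large indices only. The finite sum absorbs the others, among
    them \<open>j = 0\<close>, where the root carries no information.\<close>
  define A where "A = 1 + (\<Sum>j\<le>N. c ^ j / check_seq M j)"
  have term_pos: "c ^ j / check_seq M j > 0" for j using c0 pos[of j] by simp
  have le_A: "c ^ j / check_seq M j \<le> A" for j
  proof (cases "j \<le> N")
    case True
    then have "c ^ j / check_seq M j \<le> (\<Sum>j\<le>N. c ^ j / check_seq M j)"
      using term_pos by (intro member_le_sum) (auto simp: order.strict_implies_order)
    then show ?thesis by (simp add: A_def)
  next
    case False
    have "c ^ j \<le> (check_seq M j powr (1 / real j)) ^ j"
      using N[of j] False c0 by (intro power_mono) auto
    then have "c ^ j \<le> check_seq M j" using powr_inverse_power[OF pos, of j j] False by simp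
    then have "c ^ j / check_seq M j \<le> 1" using pos[of j] by simp
    also have "1 \<le> A" unfolding A_def using term_pos by (simp add: sum_nonneg order.strict_implies_order)
    finally show ?thesis .
  qed
  have *: "1 \<le> A * (1 / c) ^ j * check_seq M j" for j
    using le_A[of j] pos[of j] c0 by (simp add: field_simps)
  have "A > 0" unfolding A_def using term_pos by (intro add_pos_nonneg sum_nonneg) (auto simp: order.strict_implies_order)
  then show thesis using that[of A "1 / c"] * c0 by auto
qed

text \<open>Cauchy's estimates bound the derivatives by geometric multiples of l!, and l! \<le> A
  K^l M_l by assumption. So every holomorphic outer function already belongs to
  \<open>class_H M U\<close>.\<close>

lemma composition_closed_imp_holomorphically_closed:
  assumes "composition_closed M S" and M: "positive_seq M"
    and A: "A > 0" "K > 0" "\<And>j. 1 \<le> A * K ^ j * check_seq M j"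
  shows "holomorphically_closed M S"
proof -
  have "g \<in> class_H M U" if U: "open U" and g: "g holomorphic_on U" for g U
    unfolding class_H_def
  proof (intro CollectI conjI allI impI g)
    fix Z assume Z: "compact Z \<and> Z \<subseteq> U"
    obtain A' K' where A': "A' > 0" "K' > 0"
      "\<And>w l. w \<in> Z \<Longrightarrow> norm ((deriv ^^ l) g w) \<le> A' * K' ^ l * fact l"
      using deriv_bound_on_compact[OF U g conjunct1[OF Z] conjunct2[OF Z]] by blast
    have "norm ((deriv ^^ l) g w) / ((K' * K) ^ l * M l) \<le> A' * A" if "w \<in> Z" for w l
    proof -
      have "norm ((deriv ^^ l) g w) \<le> A' * K' ^ l * fact l * 1" using A'(3)[OF that] by simp
      also have "\<dots> \<le> A' * K' ^ l * fact l * (A * K ^ l * check_seq M l)"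
        using A' A(3) by (intro mult_left_mono) auto
      also have "\<dots> = A' * A * ((K' * K) ^ l * M l)"
        by (simp add: check_seq_def power_mult_distrib)
      finally show ?thesis using A A' M by (subst pos_divide_le_eq) (auto simp: positive_seq_def)
    qed
    then show "\<exists>h>0. \<exists>C. \<forall>z\<in>Z. \<forall>j. norm ((deriv ^^ j) g z) / (h ^ j * M j) \<le> C"
      using A A' by (intro exI[of _ "K' * K"]) auto
  qed
  then show ?thesis using assms(1) unfolding composition_closed_def holomorphically_closed_def by blast
qed

text \<open>The outer function is w -> 1 / w on the punctured plane; the positive infimum keeps 0
  out of the closure of the range.\<close>

lemma holomorphically_closed_imp_inverse_closed:
  assumes "holomorphically_closed M S"
  shows "inverse_closed M S"
  unfolding inverse_closed_def
proof (intro ballI impI)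
  fix f assume f: "f \<in> class_A M S" and inf: "(INF p\<in>S. cmod (f p)) > 0"
  define d where "d = (INF p\<in>S. cmod (f p))"
  have "d \<le> norm (f p)" if "p \<in> S" for p
    unfolding d_def using that by (intro cINF_lower bdd_belowI2[of _ 0]) auto
  then have "f ` S \<subseteq> {w. d \<le> norm w}" by auto
  moreover have "closed {w :: complex. d \<le> norm w}" by (intro closed_Collect_le continuous_intros)
  ultimately have "closure (f ` S) \<subseteq> {w. d \<le> norm w}" by (rule closure_minimal)
  then have "closure (f ` S) \<subseteq> - {0}" using inf by (auto simp: d_def)
  moreover have "(\<lambda>w. 1 / w) holomorphic_on - {0 :: complex}" by (intro holomorphic_intros) auto
  ultimately have "(\<lambda>w. 1 / w) \<circ> f \<in> class_A M S"
    using assms f open_Compl[OF closed_singleton[of "0::complex"]]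
    unfolding holomorphically_closed_def by blast
  then show "(\<lambda>p. 1 / f p) \<in> class_A M S" by (simp add: o_def)
qed

section \<open>From inverse-closedness to (rai)\<close>

text \<open>The factor exp p is dz/dp, so each \<open>F j\<close> has z-derivative - F (j + 1); only
  the signs accumulate.\<close>

lemma zderiv_funpow_chain:
  assumes S: "open S" and p: "p \<in> S"
    and F: "\<And>j p. p \<in> S \<Longrightarrow> (F j has_field_derivative - exp p * F (Suc j) p) (at p)"
  shows "(zderiv ^^ j) (F 0) p = (-1) ^ j * F j p"
  using p
proof (induction j arbitrary: p)
  case (Suc j)
  have d: "((\<lambda>p. (-1) ^ j * F j p) has_field_derivative (-1) ^ j * (- exp p * F (Suc j) p)) (at p)"
    by (intro DERIV_cmult F Suc.prems)
  have ev: "\<forall>\<^sub>F q in nhds p. (-1) ^ j * F j q = (zderiv ^^ j) (F 0) q"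
    using eventually_nhds_in_open[OF S Suc.prems] by eventually_elim (simp add: Suc.IH)
  have "((zderiv ^^ j) (F 0) has_field_derivative (-1) ^ j * (- exp p * F (Suc j) p)) (at p)"
    using d DERIV_cong_ev[OF refl ev refl] by simp
  then show ?case
    using zderiv_eq[of "(zderiv ^^ j) (F 0)" p] DERIV_imp_deriv field_differentiable_def by fastforce
qed simp

text \<open>All terms of the recursion for the coefficients of the reciprocal have the same sign
  after the substitution \<open>z \<mapsto> - z\<close>, so it can be bounded below by a single term.\<close>

lemma reciprocal_coeff_lower_bound:
  fixes a q :: "complex fps" and b :: "nat \<Rightarrow> real"
  assumes prod: "a * q = 1" and w: "w > 0" and a0: "fps_nth a 0 = of_real w"
    and a: "\<And>j. j \<ge> 1 \<Longrightarrow> fps_nth a j = - ((-1) ^ j * of_real (b j))" and b: "\<And>j. b j \<ge> 0"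
    and j: "j \<ge> 1"
  shows "(b j / w) ^ l / w \<le> norm (fps_nth q (l * j))"
proof -
  define s where "s n = (-1) ^ n * fps_nth q n" for n
  have q_s: "fps_nth q n = (-1) ^ n * s n" for n
    by (simp add: s_def flip: mult.assoc power_mult_distrib)
  have s0: "of_real w * s 0 = 1"
    using arg_cong[OF prod, of "\<lambda>f. fps_nth f 0"] by (simp add: fps_mult_nth a0 s_def)
  have rec: "of_real w * s n = (\<Sum>i=1..n. of_real (b i) * s (n - i))" if n: "n \<ge> 1" for n
  proof -
    have "0 = (\<Sum>i=0..n. fps_nth a i * fps_nth q (n - i))"
      using arg_cong[OF prod, of "\<lambda>f. fps_nth f n"] n by (simp add: fps_mult_nth)
    also have "\<dots> = of_real w * fps_nth q n + (\<Sum>i=1..n. fps_nth a i * fps_nth q (n - i))"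
      by (simp add: sum.atLeast_Suc_atMost a0)
    also have "(\<Sum>i=1..n. fps_nth a i * fps_nth q (n - i)) =
        - ((-1) ^ n * (\<Sum>i=1..n. of_real (b i) * s (n - i)))"
      unfolding sum_distrib_left sum_negf[symmetric]
    proof (rule sum.cong)
      fix i assume i: "i \<in> {1..n}"
      then have "(-1 :: complex) ^ n = (-1) ^ i * (-1) ^ (n - i)" by (simp flip: power_add)
      then show "fps_nth a i * fps_nth q (n - i) = - ((-1) ^ n * (of_real (b i) * s (n - i)))"
        using i a[of i] by (simp add: q_s mult_ac)
    qed simp
    finally have "(-1) ^ n * (of_real w * s n) = (-1) ^ n * (\<Sum>i=1..n. of_real (b i) * s (n - i))"
      by (simp add: q_s mult_ac)
    then show ?thesis by simp
  qed
  have s_eq: "s n = (if n = 0 then 1 else \<Sum>i=1..n. of_real (b i) * s (n - i)) / of_real w" for n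
    using s0 rec[of n] w by (auto simp: field_simps)
  have nonneg: "s n \<in> \<real> \<and> Re (s n) \<ge> 0" for n
  proof (induction n rule: less_induct)
    case (less n)
    have IH: "s (n - i) \<in> \<real>" "Re (s (n - i)) \<ge> 0" if "i \<in> {1..n}" for i
      using less[of "n - i"] that by auto
    have "(\<Sum>i=1..n. of_real (b i) * s (n - i)) \<in> \<real>"
      using IH by (intro sum_in_Reals Reals_mult) auto
    moreover have "Re (\<Sum>i=1..n. of_real (b i) * s (n - i)) \<ge> 0"
      unfolding Re_sum using IH b by (intro sum_nonneg) auto
    ultimately show ?case
      using w by (subst (1 2) s_eq) (auto simp: Re_divide_of_real intro!: Reals_divide)
  qed
  have ge: "b j * Re (s (n - j)) \<le> w * Re (s n)" if n: "n \<ge> j" for n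
  proof -
    have "w * Re (s n) = Re (of_real w * s n)" by simp
    also have "\<dots> = (\<Sum>i=1..n. b i * Re (s (n - i)))" using rec[of n] n j by simp
    also have "\<dots> \<ge> b j * Re (s (n - j))"
      using nonneg b j n by (intro member_le_sum[of j _ "\<lambda>i. b i * Re (s (n - i))"]) auto
    finally show ?thesis .
  qed
  have "(b j / w) ^ l / w \<le> Re (s (l * j))"
  proof (induction l)
    case 0
    then show ?case using s_eq[of 0] w by simp
  next
    case (Suc l)
    have "(b j / w) ^ Suc l / w = (b j / w) * ((b j / w) ^ l / w)" by simp
    also have "\<dots> \<le> (b j / w) * Re (s (l * j))"
      using Suc b w by (intro mult_left_mono) auto
    also have "\<dots> \<le> Re (s (Suc l * j))"
      using ge[of "Suc l * j"] w by (simp add: field_simps)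
    finally show ?case .
  qed
  also have "\<dots> \<le> norm (s (l * j))" by (rule complex_Re_le_cmod)
  also have "\<dots> = norm (fps_nth q (l * j))" by (simp add: s_def norm_mult norm_power)
  finally show ?thesis .
qed

lemma taylor_mult_reciprocal:
  assumes S: "open S" and p: "p \<in> S" and G: "G holomorphic_on S" and nz: "\<And>p. p \<in> S \<Longrightarrow> G p \<noteq> 0"
  shows "Abs_fps (\<lambda>n. (zderiv ^^ n) G p / fact n) * Abs_fps (\<lambda>n. (zderiv ^^ n) (\<lambda>p. 1 / G p) p / fact n) = 1"
    (is "?A * ?B = 1")
proof -
  have "(\<lambda>p. 1 / G p) holomorphic_on S" using G nz by (intro holomorphic_intros) auto
  then have B: "zchart (\<lambda>p. 1 / G p) p has_fps_expansion ?B"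
    by (rule zchart_has_fps_expansion[OF S _ p])
  have A: "zchart G p has_fps_expansion ?A" by (rule zchart_has_fps_expansion[OF S G p])
  have "isCont (zchart G p) 0" by (rule has_fps_expansion_imp_continuous[OF A])
  then have "(zchart G p \<longlongrightarrow> G p) (nhds 0)"
    by (simp add: isCont_def tendsto_nhds_iff zchart_def)
  then have "\<forall>\<^sub>F h in nhds 0. zchart G p h \<noteq> 0"
    by (rule tendsto_imp_eventually_ne) (rule nz[OF p])
  then have "\<forall>\<^sub>F h in nhds 0. zchart G p h * zchart (\<lambda>p. 1 / G p) p h = 1"
    by eventually_elim (simp add: zchart_def)
  then have "(\<lambda>h. zchart G p h * zchart (\<lambda>p. 1 / G p) p h) has_fps_expansion ?A * ?B \<longleftrightarrow>
      (\<lambda>h. 1) has_fps_expansion ?A * ?B"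
    by (rule has_fps_expansion_cong) simp
  then have "(\<lambda>h. 1 :: complex) has_fps_expansion ?A * ?B"
    using has_fps_expansion_mult[OF A B] by simp
  then show ?thesis
    using fps_expansion_unique_complex has_fps_expansion_1 by blast
qed

text \<open>The slope \<mu>_i separates the two sides: evaluated at 0 the supporting line at i gives
  L_i / L_0 \<le> \<mu>_i^i, evaluated at k it gives L_k / L_i \<ge> \<mu>_i^(k - i). Dividing by
  L_0 is necessary, as L_0 need not be 1.\<close>

lemma log_convex_root_mono:
  assumes L: "log_convex_seq L" and "i \<le> k"
  shows "(L i / L 0) ^ k \<le> (L k / L 0) ^ i"
proof -
  obtain n where n: "k = i + n" using assms le_Suc_ex by blast
  have pos: "L j > 0" "ratio_seq L j > 0" for j using log_convex_pos ratio_seq_pos L by auto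
  have 1: "L i / L 0 \<le> ratio_seq L i ^ i"
    using log_convex_ratio_power_le[OF L, of i 0] pos(1)[of 0] by (simp add: field_simps)
  have "ratio_seq L i ^ i * (ratio_seq L i ^ n * L i) \<le> ratio_seq L i ^ i * L k"
    using log_convex_ratio_power_le[OF L, of i k] by (simp add: n power_add mult_ac)
  then have 2: "ratio_seq L i ^ n * (L i / L 0) \<le> L k / L 0"
    using pos(2)[of i] pos(1)[of 0] by (simp add: divide_right_mono)
  have "(L i / L 0) ^ k = (L i / L 0) ^ n * (L i / L 0) ^ i" by (simp add: n power_add)
  also have "\<dots> \<le> (ratio_seq L i ^ i) ^ n * (L i / L 0) ^ i"
    using 1 pos(1) by (intro mult_right_mono power_mono) (auto simp: order.strict_implies_order)
  also have "\<dots> = (ratio_seq L i ^ n * (L i / L 0)) ^ i"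
  proof -
    have "(ratio_seq L i ^ i) ^ n = (ratio_seq L i ^ n) ^ i" by (simp add: mult.commute flip: power_mult)
    then show ?thesis by (simp only: power_mult_distrib)
  qed
  also have "\<dots> \<le> (L k / L 0) ^ i"
    using 2 pos by (intro power_mono) (auto simp: order.strict_implies_order)
  finally show ?thesis .
qed

lemma power_self_le_exp_fact: "real i ^ i \<le> exp (real i) * fact i"
proof -
  have *: "(\<lambda>n. inverse (fact n) * real i ^ n) sums exp (real i)"
    using exp_converges[of "real i"] by (simp add: mult.commute)
  have "inverse (fact i) * real i ^ i \<le> exp (real i)"
    using sum_le_suminf[OF sums_summable[OF *], of "{i}"] sums_unique[OF *] by simp
  then show ?thesis by (simp add: field_simps)
qed

text \<open>The constant comes from k! \<le> k^k \<le> (2 i)^k and from i^i \<le> e^i i!.\<close>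

lemma fact_power_le:
  assumes "k \<le> 2 * i"
  shows "(fact k :: real) ^ i \<le> (2 * exp 1) ^ (i * k) * fact i ^ k"
proof -
  have "(fact k :: real) \<le> real k ^ k" using fact_le_power[of k, where 'a = real] by simp
  also have "\<dots> \<le> (2 * real i) ^ k"
    by (rule power_mono) (use assms in linarith, simp)
  finally have "(fact k :: real) ^ i \<le> ((2 * real i) ^ k) ^ i"
    by (intro power_mono) auto
  also have "\<dots> = 2 ^ (i * k) * (real i ^ i) ^ k"
    by (simp add: power_mult_distrib mult.commute flip: power_mult)
  also have "\<dots> \<le> 2 ^ (i * k) * (exp (real i) * fact i) ^ k"
    by (intro mult_left_mono power_mono power_self_le_exp_fact) auto
  also have "\<dots> = (2 * exp 1) ^ (i * k) * fact i ^ k"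
    by (simp add: power_mult_distrib power_mult mult_ac flip: exp_of_nat_mult)
  finally show ?thesis .
qed

text \<open>The restriction \<open>k \<le> 2 i\<close> keeps the loss \<open>(k!)\<^sup>i / (i!)\<^sup>k\<close> geometric.\<close>

lemma check_seq_root_mono_doubling:
  assumes L: "log_convex_seq L" and M: "positive_seq M" and \<beta>: "\<beta> > 0" and A: "A > 0" "B > 0"
    and M_le: "\<And>j. M j \<le> A * B ^ j * (gevrey_weight \<beta> j * L j)" and L_le: "\<And>j. gevrey_weight \<beta> j * L j \<le> A * B ^ j * M j"
  obtains E where "E > 0" "\<And>i k. \<lbrakk>1 \<le> i; i \<le> k; k \<le> 2 * i\<rbrakk> \<Longrightarrow>
    check_seq M i ^ k \<le> E ^ (i * k) * check_seq M k ^ i"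
proof -
  \<comment> \<open>\<open>A'\<close> absorbs L_0, so that M is compared with the normalised
    sequence \<open>X\<close>, whose roots X_j^(1/j) increase.\<close>
  define A' where "A' = max 1 (max (A * L 0) (A / L 0))"
  define X where "X j = gevrey_weight \<beta> j * (L j / L 0)" for j
  have A': "A' \<ge> 1" "A * L 0 \<le> A'" "A / L 0 \<le> A'" by (auto simp: A'_def)
  have L0: "L j > 0" for j using log_convex_pos[OF L] .
  have Mpos: "M j > 0" for j using M by (simp add: positive_seq_def)
  have Xpos: "X j > 0" for j using gevrey_weight_pos[of \<beta> j] L0 by (simp add: X_def)
  have MX: "M j \<le> A' * B ^ j * X j" for j
  proof -
    have "M j \<le> (A * L 0) * (B ^ j * X j)" using M_le[of j] L0[of 0] by (simp add: X_def mult_ac)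
    also have "\<dots> \<le> A' * (B ^ j * X j)" using A'(2) A Xpos[of j] by (intro mult_right_mono) auto
    finally show ?thesis by (simp add: mult_ac)
  qed
  have XM: "X j \<le> A' * B ^ j * M j" for j
  proof -
    have "X j \<le> (A / L 0) * (B ^ j * M j)"
      using divide_right_mono[OF L_le[of j], of "L 0"] L0[of 0] by (simp add: X_def mult_ac)
    also have "\<dots> \<le> A' * (B ^ j * M j)" using A'(3) A Mpos[of j] by (intro mult_right_mono) auto
    finally show ?thesis by (simp add: mult_ac)
  qed
  have XX: "X i ^ k \<le> X k ^ i" if "i \<le> k" for i k
  proof -
    have "gevrey_weight \<beta> i ^ k \<le> gevrey_weight \<beta> k ^ i"
    proof -
      have "gevrey_weight \<beta> i ^ k = (real i powr \<beta>) ^ (i * k)" by (simp add: gevrey_weight_def power_mult)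
      also have "\<dots> \<le> (real k powr \<beta>) ^ (i * k)" using that \<beta> by (intro power_mono powr_mono2) auto
      also have "\<dots> = gevrey_weight \<beta> k ^ i" by (simp add: gevrey_weight_def mult.commute[of i k] power_mult)
      finally show ?thesis .
    qed
    then show ?thesis unfolding X_def power_mult_distrib
      using log_convex_root_mono[OF L that] gevrey_weight_pos[of \<beta>] L0
      by (intro mult_mono) (auto simp: order.strict_implies_order)
  qed
  define E where "E = A'\<^sup>2 * B\<^sup>2 * (2 * exp 1)"
  show thesis
  proof (rule that[of E])
    show "E > 0" using A A' by (simp add: E_def)
    fix i k :: nat assume ik: "1 \<le> i" "i \<le> k" "k \<le> 2 * i"
    have "i * 1 \<le> i * k" "1 * k \<le> i * k" using ik by (auto intro!: mult_le_mono)
    \<comment> \<open>The constant \<open>A'\<close> appears to the power i + k; being at least 1,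
      it can be hidden in a factor with exponent i k.\<close>
    then have exps: "i + k \<le> 2 * (i * k)" by linarith
    have "M i ^ k \<le> (A' * B ^ i * X i) ^ k" using MX Mpos by (intro power_mono) (auto simp: order.strict_implies_order)
    also have "\<dots> \<le> (A' * B ^ i) ^ k * X k ^ i"
      using XX[OF ik(2)] A A' by (simp add: power_mult_distrib mult_left_mono)
    also have "\<dots> \<le> (A' * B ^ i) ^ k * (A' * B ^ k * M k) ^ i"
      using XM Xpos A A' by (intro mult_left_mono power_mono) (auto simp: order.strict_implies_order)
    also have "\<dots> = A' ^ (i + k) * (B\<^sup>2) ^ (i * k) * M k ^ i"
      by (simp add: power_mult_distrib power_add mult_ac power2_eq_square flip: power_mult)
    also have "\<dots> \<le> A' ^ (2 * (i * k)) * (B\<^sup>2) ^ (i * k) * M k ^ i"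
      using A A' Mpos[of k] exps by (intro mult_right_mono power_increasing) auto
    also have "\<dots> = (A'\<^sup>2 * B\<^sup>2) ^ (i * k) * M k ^ i"
      by (simp add: power_mult_distrib power_mult)
    finally have 1: "M i ^ k \<le> (A'\<^sup>2 * B\<^sup>2) ^ (i * k) * M k ^ i" .
    have "check_seq M i ^ k = M i ^ k / fact i ^ k" by (simp add: check_seq_def power_divide)
    also have "\<dots> \<le> ((A'\<^sup>2 * B\<^sup>2) ^ (i * k) * M k ^ i) / fact i ^ k"
      using 1 by (intro divide_right_mono) auto
    also have "\<dots> = (A'\<^sup>2 * B\<^sup>2) ^ (i * k) * check_seq M k ^ i * (fact k ^ i / fact i ^ k)"
      by (simp add: check_seq_def power_divide)
    also have "\<dots> \<le> (A'\<^sup>2 * B\<^sup>2) ^ (i * k) * check_seq M k ^ i * (2 * exp 1) ^ (i * k)"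
      using fact_power_le[OF ik(3)] Mpos[of k]
      by (intro mult_left_mono) (auto simp: check_seq_def pos_divide_le_eq)
    also have "\<dots> = E ^ (i * k) * check_seq M k ^ i"
      by (simp add: E_def power_mult_distrib mult_ac)
    finally show "check_seq M i ^ k \<le> E ^ (i * k) * check_seq M k ^ i" .
  qed
qed

text \<open>The test function is \<open>b + 1 - F\<^sub>0\<close> with \<open>F\<close> extremal and \<open>b\<close> an upper bound for it; its
  reciprocal is expanded at a point of the positive real axis depending on \<open>j\<close>.\<close>

lemma inverse_closed_imp_power_bound:
  assumes inv: "inverse_closed M (sector \<alpha>)" and M: "positive_seq M" and M0: "M 0 = 1"
    and \<alpha>: "\<alpha> > 1" and \<beta>: "\<beta> > \<alpha> - 1" and L: "log_convex_seq L" and A: "A > 0" "B > 0"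
    and M_le: "\<And>j. M j \<le> A * B ^ j * (gevrey_weight \<beta> j * L j)" and L_le: "\<And>j. gevrey_weight \<beta> j * L j \<le> A * B ^ j * M j"
  obtains D where "D > 0" "\<And>j l. \<lbrakk>1 \<le> j; 1 \<le> l\<rbrakk> \<Longrightarrow>
    check_seq M j ^ l \<le> D ^ (l * j) * check_seq M (l * j)"
proof -
  obtain F C h c g where pos: "C > 0" "h > 0" "c > 0" "g > 0"
    and F: "\<And>j p. p \<in> sector \<alpha> \<Longrightarrow> (F j has_field_derivative - exp p * F (Suc j) p) (at p)"
    and F_le: "\<And>j p. p \<in> sector \<alpha> \<Longrightarrow> norm (F j p) \<le> C * h ^ j * (gevrey_weight \<beta> j * L j)"
    and F_real: "\<And>j x. F j (of_real x) \<in> \<real> \<and> Re (F j (of_real x)) \<ge> 0"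
    and F_ge: "\<And>j. \<exists>x. Re (F j (of_real x)) \<ge> c * g ^ j * (gevrey_weight \<beta> j * L j)"
    by (rule exists_extremal[OF \<alpha> \<beta> L]) (rule that)
  note S = open_sector[of \<alpha>]
  have real_in: "of_real x \<in> sector \<alpha>" for x
    using \<alpha> by (simp add: sector_def)
  have Mpos: "M j > 0" for j using M by (simp add: positive_seq_def)
  have F_le_M: "norm (F j p) \<le> C * A * (h * B) ^ j * M j" if "p \<in> sector \<alpha>" for j p
  proof -
    have "norm (F j p) \<le> C * h ^ j * (A * B ^ j * M j)"
      by (rule order_trans[OF F_le[OF that] mult_left_mono[OF L_le]]) (use pos in auto)
    then show ?thesis by (simp add: power_mult_distrib mult_ac)
  qed
  \<comment> \<open>Since \<open>M 0 = 1\<close>, this bounds |F 0|; the additional 1 in b + 1 will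
    keep the test function at modulus at least 1.\<close>
  define b where "b = C * A"
  have b: "b > 0" using pos A by (simp add: b_def)
  have F0_le: "norm (F 0 p) \<le> b" if "p \<in> sector \<alpha>" for p
    using F_le_M[OF that, of 0] by (simp add: M0 b_def)
  \<comment> \<open>The family of z-derivatives of the test function, up to sign. The constant is
    gone from index 1 on, so \<open>G\<close> obeys the same recursion as \<open>F\<close>.\<close>
  define G where "G j = (if j = 0 then (\<lambda>p. of_real (b + 1) - F 0 p) else (\<lambda>p. - F j p))" for j :: nat
  have G: "(G j has_field_derivative - exp p * G (Suc j) p) (at p)" if "p \<in> sector \<alpha>" for j p
  proof (cases j)
    case 0
    have "((\<lambda>p. of_real (b + 1) - F 0 p) has_field_derivative 0 - - exp p * F (Suc 0) p) (at p)"
      by (intro DERIV_diff DERIV_const F that)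
    then show ?thesis by (simp add: G_def 0)
  next
    case (Suc i)
    have "((\<lambda>p. - F (Suc i) p) has_field_derivative - (- exp p * F (Suc (Suc i)) p)) (at p)"
      by (intro DERIV_minus F that)
    then show ?thesis by (simp add: G_def Suc)
  qed
  have zG: "(zderiv ^^ j) (G 0) p = (-1) ^ j * G j p" if "p \<in> sector \<alpha>" for j p
    by (rule zderiv_funpow_chain[where F = G, OF S that G])
  have holG: "G 0 holomorphic_on sector \<alpha>"
    using G unfolding holomorphic_on_def field_differentiable_def
    using has_field_derivative_at_within by blast
  have G_class: "G 0 \<in> class_A M (sector \<alpha>)"
  proof (rule class_AI[OF holG M, where C = "2 * b + 1" and h = "h * B"])
    fix p j assume p: "p \<in> sector \<alpha>"
    have "norm (G j p) \<le> (2 * b + 1) * (h * B) ^ j * M j"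
    proof (cases "j = 0")
      case True
      have "norm (of_real (b + 1) - F 0 p) \<le> norm (of_real (b + 1) :: complex) + norm (F 0 p)"
        by (rule norm_triangle_ineq4)
      also have "\<dots> \<le> (b + 1) + b" using F0_le[OF p] b by (simp only: norm_of_real)
      finally show ?thesis using True by (simp add: G_def M0)
    next
      case False
      have "norm (G j p) \<le> b * ((h * B) ^ j * M j)"
        using F_le_M[OF p, of j] False by (simp add: G_def b_def mult.assoc)
      also have "\<dots> \<le> (2 * b + 1) * ((h * B) ^ j * M j)"
        using b pos A Mpos[of j] by (intro mult_right_mono) auto
      finally show ?thesis by (simp add: mult.assoc)
    qed
    then show "norm ((zderiv ^^ j) (G 0) p) \<le> (2 * b + 1) * (h * B) ^ j * M j"
      by (simp add: zG[OF p] norm_mult norm_power)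
  qed (use pos A in auto)
  have G_ge: "norm (G 0 p) \<ge> 1" if "p \<in> sector \<alpha>" for p
  proof -
    have "norm (of_real (b + 1) :: complex) - norm (F 0 p) \<le> norm (of_real (b + 1) - F 0 p)"
      by (rule norm_triangle_ineq2)
    then show ?thesis using F0_le[OF that] b by (simp add: G_def)
  qed
  have "(1::real) \<le> (INF p\<in>sector \<alpha>. cmod (G 0 p))"
    using G_ge real_in[of 0] by (intro cINF_greatest) auto
  then have "(INF p\<in>sector \<alpha>. cmod (G 0 p)) > 0" by linarith
  then have inv_class: "(\<lambda>p. 1 / G 0 p) \<in> class_A M (sector \<alpha>)"
    using inv[unfolded inverse_closed_def] G_class by blast
  obtain C' h' where C': "C' > 0" "h' > 0"
    and inv_le: "\<And>p j. p \<in> sector \<alpha> \<Longrightarrow> norm ((zderiv ^^ j) (\<lambda>p. 1 / G 0 p) p) \<le> C' * h' ^ j * M j"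
    by (rule class_AD[OF inv_class M]) (rule that)
  \<comment> \<open>One constant will occur to the power l, the other only once; being at least 1,
    both may be raised to the exponent l j required by the claim.\<close>
  define c1 where "c1 = max 1 ((b + 1) * A / c)"
  define c2 where "c2 = max 1 ((b + 1) * C')"
  define D where "D = c2 * c1 * (B / g) * h'"
  show thesis
  proof (rule that[of D])
    have "c1 \<ge> 1" "c2 \<ge> 1" by (auto simp: c1_def c2_def)
    then show "D > 0" using A pos C' by (simp add: D_def)
    fix j l :: nat assume jl: "1 \<le> j" "1 \<le> l"
    obtain x where x: "Re (F j (of_real x)) \<ge> c * g ^ j * (gevrey_weight \<beta> j * L j)" using F_ge by blast
    define p where "p = complex_of_real x"
    have p: "p \<in> sector \<alpha>" by (simp add: p_def real_in)
    \<comment> \<open>The value of the test function at p. Its upper bound b + 1 does not depend on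
      j, so choosing the point according to j does no harm.\<close>
    define w where "w = b + 1 - Re (F 0 p)"
    have F_of_real: "F i p = of_real (Re (F i p))" for i
      using F_real[of i x] unfolding p_def by (metis of_real_Re)
    have Re_le: "Re (F 0 p) \<le> b" using complex_Re_le_cmod[of "F 0 p"] F0_le[OF p] by linarith
    have w: "w > 0" "w \<le> b + 1" using Re_le F_real[of 0 x] by (auto simp: w_def p_def)
    have "(Re (F j p) / fact j / w) ^ l / w
        \<le> norm (fps_nth (Abs_fps (\<lambda>n. (zderiv ^^ n) (\<lambda>p. 1 / G 0 p) p / fact n)) (l * j))"
    proof (rule reciprocal_coeff_lower_bound[OF taylor_mult_reciprocal[OF S p holG] w(1) _ _ _ jl(1),
        where b = "\<lambda>j. Re (F j p) / fact j"])
      show "fps_nth (Abs_fps (\<lambda>n. (zderiv ^^ n) (G 0) p / fact n)) 0 = of_real w"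
        by (simp add: G_def w_def F_of_real[of 0, symmetric])
      show "fps_nth (Abs_fps (\<lambda>n. (zderiv ^^ n) (G 0) p / fact n)) i = - ((-1) ^ i * of_real (Re (F i p) / fact i))"
        if "i \<ge> 1" for i
      proof -
        have "G i p = - F i p" using that by (simp add: G_def)
        then show ?thesis by (simp add: zG[OF p] F_of_real[of i, symmetric])
      qed
      show "0 \<le> Re (F i p) / fact i" for i
        using F_real[of i x] by (simp add: p_def)
      show "G 0 q \<noteq> 0" if "q \<in> sector \<alpha>" for q
        using G_ge[OF that] by auto
    qed
    also have "\<dots> \<le> C' * h' ^ (l * j) * check_seq M (l * j)"
      using inv_le[OF p, of "l * j"] by (simp add: norm_divide check_seq_def divide_right_mono)
    finally have upper: "(Re (F j p) / fact j / w) ^ l / w \<le> C' * h' ^ (l * j) * check_seq M (l * j)" .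
    \<comment> \<open>The lower bound for \<open>F j\<close> with the weight replaced by M_j through
      \<open>M_le\<close>, and with w replaced by b + 1.\<close>
    define t where "t = c / (A * (b + 1)) * (g / B) ^ j * check_seq M j"
    have m: "check_seq M i > 0" for i by (rule check_seq_pos[OF M])
    have t: "t > 0" using pos A b m by (simp add: t_def)
    have "t \<le> Re (F j p) / fact j / w"
    proof -
      have "c / A * (g / B) ^ j * M j \<le> c / A * (g / B) ^ j * (A * B ^ j * (gevrey_weight \<beta> j * L j))"
        using M_le pos A by (intro mult_left_mono) auto
      also have "\<dots> = c * g ^ j * (gevrey_weight \<beta> j * L j)"
        using A by (simp add: power_divide)
      also have "\<dots> \<le> Re (F j p)" using x by (simp add: p_def)
      finally have "c / A * (g / B) ^ j * M j / fact j / (b + 1) \<le> Re (F j p) / fact j / (b + 1)"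
        using b by (intro divide_right_mono) auto
      also have "\<dots> \<le> Re (F j p) / fact j / w"
        using w F_real[of j x] b by (intro divide_left_mono) (auto simp: p_def)
      finally show ?thesis by (simp add: t_def check_seq_def mult_ac)
    qed
    then have "t ^ l \<le> (Re (F j p) / fact j / w) ^ l" using t by (intro power_mono) auto
    also have "\<dots> \<le> w * (C' * h' ^ (l * j) * check_seq M (l * j))"
      using upper w by (simp add: pos_divide_le_eq mult.commute)
    also have "\<dots> \<le> (b + 1) * (C' * h' ^ (l * j) * check_seq M (l * j))"
      using w C' m[of "l * j"] by (intro mult_right_mono) auto
    finally have t_le: "t ^ l \<le> (b + 1) * C' * (h' ^ (l * j) * check_seq M (l * j))"
      by (simp add: mult_ac)
    have m_t: "check_seq M j = ((b + 1) * A / c) * (B / g) ^ j * t"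
      using pos A b by (simp add: t_def power_divide)
    have "check_seq M j ^ l = ((b + 1) * A / c) ^ l * (B / g) ^ (l * j) * t ^ l"
      unfolding m_t by (simp only: power_mult_distrib mult.commute[of l j] power_mult)
    also have "\<dots> \<le> c1 ^ (l * j) * (B / g) ^ (l * j) * (c2 ^ (l * j) * (h' ^ (l * j) * check_seq M (l * j)))"
    proof (intro mult_mono)
      have "((b + 1) * A / c) ^ l \<le> c1 ^ l"
        using b A pos by (intro power_mono) (auto simp: c1_def)
      also have "\<dots> \<le> c1 ^ (l * j)" using jl by (intro power_increasing) (auto simp: c1_def)
      finally show "((b + 1) * A / c) ^ l \<le> c1 ^ (l * j)" .
      have "(b + 1) * C' \<le> c2 ^ 1" by (simp add: c2_def)
      also have "\<dots> \<le> c2 ^ (l * j)" using jl mult_le_mono[of 1 l 1 j] by (intro power_increasing) (auto simp: c2_def)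
      finally have "(b + 1) * C' * (h' ^ (l * j) * check_seq M (l * j)) \<le> c2 ^ (l * j) * (h' ^ (l * j) * check_seq M (l * j))"
        using C' m[of "l * j"] by (intro mult_right_mono) auto
      with t_le show "t ^ l \<le> c2 ^ (l * j) * (h' ^ (l * j) * check_seq M (l * j))" by linarith
    qed (use pos A t \<open>c1 \<ge> 1\<close> in auto)
    also have "\<dots> = D ^ (l * j) * check_seq M (l * j)"
      unfolding D_def power_mult_distrib by (simp add: mult_ac)
    finally show "check_seq M j ^ l \<le> D ^ (l * j) * check_seq M (l * j)" .
  qed
qed

text \<open>Rounding k down to the multiple i = l j leaves k \<le> 2 i, the range in which roots of
  m are comparable. The power bound leads from j to i, the comparison from i to k; everything is
  raised to the power l, which is cancelled at the end.\<close>

lemma inverse_closed_imp_rai: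
  assumes inv: "inverse_closed M (sector \<alpha>)" and M: "positive_seq M" and M0: "M 0 = 1"
    and \<alpha>: "\<alpha> > 1" and \<beta>: "\<beta> > \<alpha> - 1" and L: "log_convex_seq L" and A: "A > 0" "B > 0"
    and M_le: "\<And>j. M j \<le> A * B ^ j * (gevrey_weight \<beta> j * L j)" and L_le: "\<And>j. gevrey_weight \<beta> j * L j \<le> A * B ^ j * M j"
  shows "rai M"
proof -
  obtain D where D: "D > 0" "\<And>j l. \<lbrakk>1 \<le> j; 1 \<le> l\<rbrakk> \<Longrightarrow>
      check_seq M j ^ l \<le> D ^ (l * j) * check_seq M (l * j)"
    using inverse_closed_imp_power_bound[OF assms] by blast
  have "\<beta> > 0" using \<alpha> \<beta> by simp
  from check_seq_root_mono_doubling[OF L M this A M_le L_le]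
  obtain E where E: "E > 0" "\<And>i k. \<lbrakk>1 \<le> i; i \<le> k; k \<le> 2 * i\<rbrakk> \<Longrightarrow>
      check_seq M i ^ k \<le> E ^ (i * k) * check_seq M k ^ i"
    by blast
  note m = order.strict_implies_order[OF check_seq_pos[OF M]]
  show ?thesis
  proof (rule raiI[OF M, of "D * E"])
    show "D * E > 0" using D E by simp
    fix j k :: nat assume jk: "1 \<le> j" "j \<le> k"
    define l where "l = k div j"
    define i where "i = l * j"
    have l: "l \<ge> 1" using jk by (simp add: l_def Suc_le_eq div_greater_zero_iff)
    have "k = i + k mod j" "k mod j < j" using jk by (auto simp: i_def l_def)
    moreover have "j \<le> i" using l by (simp add: i_def)
    ultimately have i: "1 \<le> i" "i \<le> k" "k \<le> 2 * i" using jk by linarith+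
    have "(check_seq M j ^ k) ^ l = (check_seq M j ^ l) ^ k"
      by (simp add: mult.commute flip: power_mult)
    also have "\<dots> \<le> (D ^ i * check_seq M i) ^ k"
      unfolding i_def using D(2)[OF jk(1) l] m by (intro power_mono) auto
    also have "\<dots> = D ^ (i * k) * check_seq M i ^ k" by (simp add: power_mult_distrib power_mult)
    also have "\<dots> \<le> D ^ (i * k) * (E ^ (i * k) * check_seq M k ^ i)"
      using E(2)[OF i] D(1) by (intro mult_left_mono) auto
    also have "\<dots> = ((D * E) ^ (j * k) * check_seq M k ^ j) ^ l"
      by (simp add: i_def power_mult_distrib mult_ac flip: power_mult)
    finally show "check_seq M j ^ k \<le> (D * E) ^ (j * k) * check_seq M k ^ j"
      using l D E m by (subst (asm) power_mono_iff) auto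
  qed
qed

lemma gevrey_scale_eq: "gevrey_scale (- \<beta>) M j = M j / gevrey_weight \<beta> j"
  by (cases "j = 0") (simp_all add: gevrey_scale_def gevrey_weight_def powr_minus powr_powr divide_inverse mult.commute flip: powr_realpow)

theorem corollary5p16:
  fixes M :: "nat \<Rightarrow> real" and \<alpha> :: real
  assumes "positive_seq M" and "M 0 = 1" and "\<alpha> > 1"
    and "\<exists>\<alpha>'>\<alpha>. \<exists>L. log_convex_seq L \<and> equivalent_seq (gevrey_scale (1 - \<alpha>') M) L"
  shows "(rai M \<longleftrightarrow> holomorphically_closed M (sector \<alpha>)) \<and>
    (rai M \<longleftrightarrow> inverse_closed M (sector \<alpha>)) \<and>
    (liminf (\<lambda>j. ereal ((M j / fact j) powr (1 / real j))) > 0 \<and> dc M \<longrightarrow>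
      (rai M \<longleftrightarrow> composition_closed M (sector \<alpha>)) \<and>
      (rai M \<longleftrightarrow> FdB M))"
proof -
  note M = assms(1) and M0 = assms(2) and \<alpha> = assms(3)
  obtain \<alpha>' L where \<alpha>': "\<alpha>' > \<alpha>" and L: "log_convex_seq L"
    and eqv: "equivalent_seq (gevrey_scale (1 - \<alpha>') M) L"
    using assms(4) by blast
  define \<beta> where "\<beta> = \<alpha>' - 1"
  have \<beta>: "\<beta> > \<alpha> - 1" using \<alpha>' by (simp add: \<beta>_def)
  have "1 - \<alpha>' = - \<beta>" by (simp add: \<beta>_def)
  then obtain A B where A: "A > 0" "B > 0"
    and le: "\<And>j. M j / gevrey_weight \<beta> j \<le> A * B ^ j * L j" "\<And>j. L j \<le> A * B ^ j * (M j / gevrey_weight \<beta> j)"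
    using eqv unfolding equivalent_seq_def by (auto simp: gevrey_scale_eq)
  \<comment> \<open>The hypothesis now says that M_j is equivalent to j^(\<beta> j) L_j, the size of
    the derivatives of the extremal function.\<close>
  have M_le: "M j \<le> A * B ^ j * (gevrey_weight \<beta> j * L j)" and L_le: "gevrey_weight \<beta> j * L j \<le> A * B ^ j * M j" for j
    using le[of j] gevrey_weight_pos[of \<beta> j] by (simp_all add: field_simps)
  note S = open_sector[of \<alpha>]
  have ab: "rai M \<Longrightarrow> holomorphically_closed M (sector \<alpha>)"
    using rai_imp_holomorphically_closed[OF _ M M0 S] .
  have bc: "holomorphically_closed M (sector \<alpha>) \<Longrightarrow> inverse_closed M (sector \<alpha>)"
    by (rule holomorphically_closed_imp_inverse_closed)
  have ca: "inverse_closed M (sector \<alpha>) \<Longrightarrow> rai M"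
    by (rule inverse_closed_imp_rai[OF _ M M0 \<alpha> \<beta> L A M_le L_le])
  have ed: "FdB M \<Longrightarrow> composition_closed M (sector \<alpha>)"
    using FdB_imp_composition_closed[OF _ M M0 S] .
  have "(rai M \<longleftrightarrow> composition_closed M (sector \<alpha>)) \<and> (rai M \<longleftrightarrow> FdB M)"
    if lim: "liminf (\<lambda>j. ereal ((M j / fact j) powr (1 / real j))) > 0" and dc: "dc M"
  proof -
    obtain A' K where "A' > 0" "K > 0" "\<And>j. 1 \<le> A' * K ^ j * check_seq M j"
      using liminf_root_pos[OF lim M] by blast
    then have db: "composition_closed M (sector \<alpha>) \<Longrightarrow> holomorphically_closed M (sector \<alpha>)"
      using composition_closed_imp_holomorphically_closed[OF _ M] by blast
    have ae: "rai M \<Longrightarrow> FdB M" using rai_dc_imp_FdB[OF _ M M0 dc] .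
    \<comment> \<open>The cycle is (a), (e), (d), (b), (c), (a). Condition (dc) enters from (a) to
      (e), the liminf from (d) to (b).\<close>
    show ?thesis using bc ca ed db ae by blast
  qed
  then show ?thesis using ab bc ca by blast
qed

end
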